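(* If $k\geq 2$ is odd then $\mathrm{ex}(n,C_3,\textnormal{rainbow-}C_{2k})=\Omega(n^{1+1/k})$, and if $k\geq 2$ is even then $\mathrm{ex}(n,C_3,\textnormal{rainbow-}C_{2k+1})=\Omega(n^{1+1/k})$. Furthermore, for every integer $k\geq 2$, \[\mathrm{ex}(n,C_3,\textnormal{rainbow-}C_{2k})=O(\mathrm{ex}^*(n,C_{2k})),\] and \begin{align*} \mathrm{ex}(n,C_3,\textnormal{rainbow-}C_{2k})&\geq \mathrm{ex}(n,C_3,C_{2k})=\Omega(\mathrm{ex}(n,\{C_4,C_6,\dots,C_{2k}\})),\\ \mathrm{ex}(n,C_3,\textnormal{rainbow-}C_{2k+1})&\geq \mathrm{ex}(n,C_3,C_{2k+1})=\Omega(\mathrm{ex}(n,\{C_4,C_6,\dots,C_{2k}\})). \end{align*}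
   Context: A proper edge-colouring of a graph assigns colours to edges so that any two edges sharing a vertex receive different colours. A subgraph of an edge-coloured graph is rainbow if all its edges have distinct colours. For graphs $H,F$: $\mathrm{ex}(n,H,\textnormal{rainbow-}F)$ is the maximum number of copies of $H$ in a properly edge-coloured $n$-vertex graph with no rainbow subgraph isomorphic to $F$; $\mathrm{ex}(n,H,F)$ is the maximum number of copies of $H$ in an $n$-vertex graph with no subgraph isomorphic to $F$; $\mathrm{ex}^*(n,F)$ is the maximum number of edges of a properly edge-coloured $n$-vertex graph with no rainbow copy of $F$; for a family $\mathcal F$ of graphs, $\mathrm{ex}(n,\mathcal F)$ is the maximum number of edges in an $n$-vertex graph containing no member of $\mathcal F$ as a subgraph. $C_m$ is the cycle of length $m$. Implied constants may depend on $k$. *)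

theory Defs
  imports "HOL-Library.Landau_Symbols"
begin

type_synonym 'a ugraph = "'a set \<times> 'a set set"

abbreviation verts :: "'a ugraph \<Rightarrow> 'a set" where "verts \<equiv> fst"

abbreviation edges :: "'a ugraph \<Rightarrow> 'a set set" where "edges \<equiv> snd"

definition simple_graph :: "'a ugraph \<Rightarrow> bool" where
  "simple_graph G \<longleftrightarrow> finite (verts G) \<and> (\<forall>e \<in> edges G. e \<subseteq> verts G \<and> card e = 2)"

definition subgraph :: "'a ugraph \<Rightarrow> 'a ugraph \<Rightarrow> bool" where
  "subgraph S G \<longleftrightarrow> simple_graph S \<and> verts S \<subseteq> verts G \<and> edges S \<subseteq> edges G"

definition isomorphic :: "'a ugraph \<Rightarrow> 'b ugraph \<Rightarrow> bool" where
  "isomorphic G H \<longleftrightarrow> (\<exists>f. bij_betw f (verts G) (verts H) \<and> (\<lambda>e. f ` e) ` edges G = edges H)"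

text \<open>Copies are unlabelled: they are the subgraphs isomorphic to the given graph,
  so a triangle is counted once and not six times.\<close>

definition copies :: "'b ugraph \<Rightarrow> 'a ugraph \<Rightarrow> 'a ugraph set" where
  "copies H G = {S. subgraph S G \<and> isomorphic S H}"

text \<open>Meaningful only for \<open>m \<ge> 3\<close>.\<close>

definition cycle_graph :: "nat \<Rightarrow> nat ugraph" where
  "cycle_graph m = ({..<m}, {{i, (i + 1) mod m} | i. i < m})"

text \<open>Natural-number colours are no restriction, since all graphs here are finite.
  Values of the colouring outside the edge set are irrelevant.\<close>

definition proper_edge_colouring :: "'a ugraph \<Rightarrow> ('a set \<Rightarrow> nat) \<Rightarrow> bool" where
  "proper_edge_colouring G c \<longleftrightarrow>
     (\<forall>e \<in> edges G. \<forall>f \<in> edges G. e \<noteq> f \<and> e \<inter> f \<noteq> {} \<longrightarrow> c e \<noteq> c f)"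

definition rainbow :: "('a set \<Rightarrow> nat) \<Rightarrow> 'a ugraph \<Rightarrow> bool" where
  "rainbow c S \<longleftrightarrow> inj_on c (edges S)"

definition free_of :: "'b ugraph \<Rightarrow> 'a ugraph \<Rightarrow> bool" where
  "free_of F G \<longleftrightarrow> copies F G = {}"

definition rainbow_free_of :: "'b ugraph \<Rightarrow> 'a ugraph \<Rightarrow> ('a set \<Rightarrow> nat) \<Rightarrow> bool" where
  "rainbow_free_of F G c \<longleftrightarrow> \<not> (\<exists>S \<in> copies F G. rainbow c S)"

text \<open>Up to isomorphism, every graph on \<open>n\<close> vertices has its vertices among the natural numbers.\<close>

definition n_vertex_graph :: "nat \<Rightarrow> nat ugraph \<Rightarrow> bool" where
  "n_vertex_graph n G \<longleftrightarrow> simple_graph G \<and> card (verts G) = n"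

text \<open>The four extremal numbers \<open>ex(n, H, rainbow-F)\<close>, \<open>ex(n, H, F)\<close>, \<open>ex\<^sup>*(n, F)\<close>
  and \<open>ex(n, \<F>)\<close>.\<close>

definition ex_copies_rainbow :: "nat \<Rightarrow> 'b ugraph \<Rightarrow> 'c ugraph \<Rightarrow> nat" where
  "ex_copies_rainbow n H F =
     Max {card (copies H G) | G c.
            n_vertex_graph n G \<and> proper_edge_colouring G c \<and> rainbow_free_of F G c}"

definition ex_copies :: "nat \<Rightarrow> 'b ugraph \<Rightarrow> 'c ugraph \<Rightarrow> nat" where
  "ex_copies n H F = Max {card (copies H G) | G. n_vertex_graph n G \<and> free_of F G}"

definition ex_star :: "nat \<Rightarrow> 'c ugraph \<Rightarrow> nat" where
  "ex_star n F =
     Max {card (edges G) | G c.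
            n_vertex_graph n G \<and> proper_edge_colouring G c \<and> rainbow_free_of F G c}"

definition ex_family :: "nat \<Rightarrow> 'c ugraph set \<Rightarrow> nat" where
  "ex_family n \<F> = Max {card (edges G) | G. n_vertex_graph n G \<and> (\<forall>F \<in> \<F>. free_of F G)}"

text \<open>The maxima are taken over finite sets, which are nonempty when the forbidden graphs
  have an edge.\<close>

lemma edges_subset_Pow: "simple_graph G \<Longrightarrow> edges G \<subseteq> Pow (verts G)"
  by (auto simp: simple_graph_def)

lemma card_edges_le:
  assumes "n_vertex_graph n G" shows "card (edges G) \<le> 2 ^ n"
proof -
  have "finite (verts G)" "edges G \<subseteq> Pow (verts G)"
    using assms edges_subset_Pow by (auto simp: n_vertex_graph_def simple_graph_def)
  then have "card (edges G) \<le> card (Pow (verts G))" by (intro card_mono) auto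
  then show ?thesis using assms \<open>finite (verts G)\<close> by (simp add: card_Pow n_vertex_graph_def)
qed

lemma card_copies_le:
  assumes "n_vertex_graph n G" shows "card (copies H G) \<le> 2 ^ n * 2 ^ (2 ^ n)"
proof -
  have fin: "finite (verts G)" using assms by (simp add: n_vertex_graph_def simple_graph_def)
  have "copies H G \<subseteq> Pow (verts G) \<times> Pow (Pow (verts G))"
    using edges_subset_Pow by (fastforce simp: copies_def subgraph_def)
  then have "card (copies H G) \<le> card (Pow (verts G) \<times> Pow (Pow (verts G)))"
    using fin by (intro card_mono) auto
  then show ?thesis
    using assms fin by (simp add: card_Pow card_cartesian_product n_vertex_graph_def)
qed

lemma finite_copy_counts: "finite {card (copies H G) | G c. n_vertex_graph n G \<and> P G c}"
  by (rule finite_subset[OF _ finite_atMost[of "2 ^ n * 2 ^ (2 ^ n)"]]) (use card_copies_le in blast)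

lemma finite_edge_counts: "finite {card (edges G) | G c. n_vertex_graph n G \<and> P G c}"
  by (rule finite_subset[OF _ finite_atMost[of "2 ^ n"]]) (use card_edges_le in blast)

lemma empty_graph_admissible:
  fixes n :: nat and F :: "'c ugraph"
  defines "G \<equiv> ({..<n}, {})"
  assumes "edges F \<noteq> {}"
  shows "n_vertex_graph n G" "free_of F G" "proper_edge_colouring G c" "rainbow_free_of F G c"
  using assms by (auto simp: n_vertex_graph_def simple_graph_def free_of_def copies_def
      subgraph_def isomorphic_def proper_edge_colouring_def rainbow_free_of_def)

end

(* For the explicit lower bound let q be a power of 2 and take the bipartite graph on two copies of
   GF(q)^k that joins v to v + (x, x^3, ..., x^(2k-1)) with colour x. Any 2k of these vectors are
   linearly independent over GF(2) (BCH codes), so along a closed walk of length at most 2k that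
   uses no colour more than twice every colour occurs an even number of times. Now replace every
   vertex w on one side by an edge w'w'', with the two copies of an edge coloured (x,1) and (x,2): each edge of the bipartite
   graph gives a triangle. On a rainbow cycle of length at most 2k+1 equally many edges have second
   colour coordinate 1 and 2, and counting the ends at w' modulo 2 excludes the two cycle lengths
   of the theorem.

   The same doubling of one side of a bipartite subgraph turns a graph without C_4, ..., C_2k into
   one without cycles of length 5, ..., 2k+1, since a short cycle projects to a walk in a forest.
   This leaves out C_4, for which the polarity graph over GF(q), whose edges almost all lie in
   triangles, matches the Kovari-Sos-Turan bound.

   For the upper bound, a neighbourhood with more than 6k times as many edges as vertices contains,
   greedily, a rainbow path that closes up to a rainbow C_2k through its centre; hence the number of
   triangles is linear in the number of edges. *)
theory Submission
  imports Defs "HOL-Algebra.Algebraic_Closure_Type" "HOL-Library.Z2"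
begin

section \<open>Cycles and triangles in graphs\<close>

text \<open>The parity of k enters as follows. All edges w'w'' can share one colour because they
  form a matching, so a rainbow cycle uses b <= 1 of them, besides a spokes to first copies and a
  spokes to second copies. Its length is 2a + b, and counting ends at w' makes a + b even. Only
  lengths congruent to 0 or 3 modulo 4 survive: 2k is excluded for odd k, and 2k + 1 for even k. In
  the uncoloured bounds C_4 is a real obstacle to doubling: two neighbours of w form a C_4 with w'
  and w''. So C_4 for k = 2 is the one case in which the extremal number of the family has to be
  estimated from above and matched by another graph. Doubling can also double the number of
  vertices. The given graph is therefore first restricted to half of its vertices at the cost of a
  constant factor in the edges, which replaces a comparison of the extremal numbers for n and
  n/2.\<close>

definition triangles :: "'a set set \<Rightarrow> 'a set set" where
  "triangles E = {{a, b, c} | a b c. a \<noteq> b \<and> b \<noteq> c \<and> a \<noteq> c \<and> {a, b} \<in> E \<and> {b, c} \<in> E \<and> {a, c} \<in> E}"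

lemma trianglesI:
  "a \<noteq> b \<Longrightarrow> b \<noteq> c \<Longrightarrow> a \<noteq> c \<Longrightarrow> {a, b} \<in> E \<Longrightarrow> {b, c} \<in> E \<Longrightarrow> {a, c} \<in> E \<Longrightarrow> {a, b, c} \<in> triangles E"
  unfolding triangles_def by blast

lemma trianglesE:
  assumes "T \<in> triangles E"
  obtains a b c where "T = {a, b, c}" "a \<noteq> b" "b \<noteq> c" "a \<noteq> c" "{a, b} \<in> E" "{b, c} \<in> E" "{a, c} \<in> E"
  using assms unfolding triangles_def by blast

text \<open>The vertices in cyclic order. One copy of C_m has many such sequences, which is harmless
  since cycles only matter through their existence; the copies that get counted are
  triangles.\<close>

definition cycle_in :: "'a set set \<Rightarrow> nat \<Rightarrow> (nat \<Rightarrow> 'a) \<Rightarrow> bool" where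
  "cycle_in E m f \<longleftrightarrow> inj_on f {..<m} \<and> (\<forall>i<m. {f i, f (Suc i mod m)} \<in> E)"

lemma edges_cycle_graph: "edges (cycle_graph m) = (\<lambda>i. {i, Suc i mod m}) ` {..<m}"
  by (auto simp: cycle_graph_def)

lemma verts_cycle_graph: "verts (cycle_graph m) = {..<m}"
  by (simp add: cycle_graph_def)

lemma edges_cycle_graph_nonempty: "m > 0 \<Longrightarrow> edges (cycle_graph m) \<noteq> {}"
  by (auto simp: edges_cycle_graph)

text \<open>If two steps used the same edge, each index would be the cyclic successor of the other,
  which happens only for m = 2.\<close>

lemma inj_on_cycle_edge:
  assumes "inj_on f {..<m}" "m \<ge> 3"
  shows "inj_on (\<lambda>i. {f i, f (Suc i mod m)}) {..<m}"
proof (rule inj_onI)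
  fix i j assume ij: "i \<in> {..<m}" "j \<in> {..<m}"
    and eq: "{f i, f (Suc i mod m)} = {f j, f (Suc j mod m)}"
  show "i = j"
  proof (rule ccontr)
    assume "i \<noteq> j"
    with eq have "f i = f (Suc j mod m)" "f j = f (Suc i mod m)"
      using inj_onD[OF assms(1)] ij by (auto simp: doubleton_eq_iff)
    then have "i = Suc j mod m" "j = Suc i mod m"
      using inj_onD[OF assms(1)] ij assms(2) by auto
    moreover have "Suc l mod m = (if Suc l = m then 0 else Suc l)" if "l < m" for l
      using that by (auto simp: mod_if)
    ultimately show False
      using ij assms(2) by (auto split: if_splits)
  qed
qed

text \<open>The inverse of an isomorphism onto \<open>cycle_graph m\<close> lists the vertices of
  the copy in cyclic order. Through this lemma all arguments about cycles can work with sequences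
  instead of isomorphisms.\<close>

lemma copy_cycle_iff:
  assumes "simple_graph G" "m > 0"
  shows "S \<in> copies (cycle_graph m) G \<longleftrightarrow>
    (\<exists>f. cycle_in (edges G) m f \<and> S = (f ` {..<m}, (\<lambda>i. {f i, f (Suc i mod m)}) ` {..<m}))"
proof
  assume "S \<in> copies (cycle_graph m) G"
  then obtain h where S: "simple_graph S" "verts S \<subseteq> verts G" "edges S \<subseteq> edges G"
    and h: "bij_betw h (verts S) {..<m}" "(\<lambda>e. h ` e) ` edges S = edges (cycle_graph m)"
    by (auto simp: copies_def subgraph_def isomorphic_def verts_cycle_graph)
  define f where "f = inv_into (verts S) h"
  have f: "bij_betw f {..<m} (verts S)" unfolding f_def by (rule bij_betw_inv_into[OF h(1)])
  have fh: "f ` (h ` e) = e" if "e \<in> edges S" for e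
  proof -
    have "e \<subseteq> verts S" using S(1) that by (auto simp: simple_graph_def)
    then show ?thesis
      using h(1) unfolding f_def bij_betw_def by (metis inv_into_image_cancel)
  qed
  have "edges S = (\<lambda>e. f ` h ` e) ` edges S" using fh by force
  also have "\<dots> = (\<lambda>e. f ` e) ` edges (cycle_graph m)" by (simp add: image_image flip: h(2))
  also have "\<dots> = (\<lambda>i. {f i, f (Suc i mod m)}) ` {..<m}"
    by (simp add: edges_cycle_graph image_image)
  finally have e: "edges S = (\<lambda>i. {f i, f (Suc i mod m)}) ` {..<m}" .
  have "cycle_in (edges G) m f"
    using f e S(3) by (auto simp: cycle_in_def bij_betw_def)
  moreover have "S = (f ` {..<m}, (\<lambda>i. {f i, f (Suc i mod m)}) ` {..<m})"
    using e f by (metis bij_betw_def prod.collapse)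
  ultimately show "\<exists>f. cycle_in (edges G) m f \<and> S = (f ` {..<m}, (\<lambda>i. {f i, f (Suc i mod m)}) ` {..<m})"
    by blast
next
  assume "\<exists>f. cycle_in (edges G) m f \<and> S = (f ` {..<m}, (\<lambda>i. {f i, f (Suc i mod m)}) ` {..<m})"
  then obtain f where f: "inj_on f {..<m}" "\<And>i. i < m \<Longrightarrow> {f i, f (Suc i mod m)} \<in> edges G"
    and S: "S = (f ` {..<m}, (\<lambda>i. {f i, f (Suc i mod m)}) ` {..<m})"
    by (auto simp: cycle_in_def)
  have V: "f i \<in> verts G" if "i < m" for i
    using f(2)[OF that] assms(1) by (auto simp: simple_graph_def)
  have "simple_graph S"
    using f(2) assms by (force simp: S simple_graph_def)
  then have "subgraph S G"
    using f(2) V by (auto simp: S subgraph_def)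
  moreover define h where "h = inv_into {..<m} f"
  have hf: "h (f i) = i" if "i < m" for i using that f(1) by (simp add: h_def)
  have "isomorphic S (cycle_graph m)"
    unfolding isomorphic_def
  proof (intro exI[of _ h] conjI)
    show "bij_betw h (verts S) (verts (cycle_graph m))"
      unfolding S verts_cycle_graph h_def using bij_betw_inv_into[OF inj_on_imp_bij_betw[OF f(1)]] by simp
    show "(\<lambda>e. h ` e) ` edges S = edges (cycle_graph m)"
      using assms(2) by (simp add: S edges_cycle_graph image_image hf)
  qed
  ultimately show "S \<in> copies (cycle_graph m) G"
    by (simp add: copies_def)
qed

lemma bex_copies_cycle:
  assumes "simple_graph G" "m > 0"
  shows "(\<exists>S\<in>copies (cycle_graph m) G. P S) \<longleftrightarrow>
    (\<exists>f. cycle_in (edges G) m f \<and> P (f ` {..<m}, (\<lambda>i. {f i, f (Suc i mod m)}) ` {..<m}))"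
proof
  assume "\<exists>S\<in>copies (cycle_graph m) G. P S"
  then obtain S where "S \<in> copies (cycle_graph m) G" "P S" ..
  then show "\<exists>f. cycle_in (edges G) m f \<and> P (f ` {..<m}, (\<lambda>i. {f i, f (Suc i mod m)}) ` {..<m})"
    unfolding copy_cycle_iff[OF assms] by (elim exE conjE) (intro exI conjI, assumption, simp)
next
  assume "\<exists>f. cycle_in (edges G) m f \<and> P (f ` {..<m}, (\<lambda>i. {f i, f (Suc i mod m)}) ` {..<m})"
  then obtain f where f: "cycle_in (edges G) m f" "P (f ` {..<m}, (\<lambda>i. {f i, f (Suc i mod m)}) ` {..<m})"
    by (elim exE conjE)
  from f(1) have "(f ` {..<m}, (\<lambda>i. {f i, f (Suc i mod m)}) ` {..<m}) \<in> copies (cycle_graph m) G"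
    unfolding copy_cycle_iff[OF assms] by (intro exI[of _ f]) simp
  with f(2) show "\<exists>S\<in>copies (cycle_graph m) G. P S" ..
qed

lemma free_of_cycle_iff:
  assumes "simple_graph G" "m > 0"
  shows "free_of (cycle_graph m) G \<longleftrightarrow> (\<nexists>f. cycle_in (edges G) m f)"
  using bex_copies_cycle[OF assms, of "\<lambda>_. True"] unfolding free_of_def
  by (simp only: simp_thms bex_simps ex_in_conv Bex_def) metis

lemma rainbow_free_of_cycle_iff:
  assumes "simple_graph G" "m \<ge> 3"
  shows "rainbow_free_of (cycle_graph m) G c \<longleftrightarrow>
    (\<nexists>f. cycle_in (edges G) m f \<and> inj_on (\<lambda>i. c {f i, f (Suc i mod m)}) {..<m})"
proof -
  have "rainbow c (f ` {..<m}, (\<lambda>i. {f i, f (Suc i mod m)}) ` {..<m}) \<longleftrightarrow>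
    inj_on (\<lambda>i. c {f i, f (Suc i mod m)}) {..<m}" if "cycle_in (edges G) m f" for f
    using that comp_inj_on_iff[OF inj_on_cycle_edge[of f m], of c] assms(2)
    by (simp add: rainbow_def cycle_in_def comp_def)
  moreover have "m > 0" using assms(2) by simp
  ultimately show ?thesis
    unfolding rainbow_free_of_def bex_copies_cycle[OF assms(1) \<open>m > 0\<close>]
    by (simp cong: conj_cong)
qed

text \<open>A copy of C_3 is determined by its vertex set, because its edges are all the pairs of
  its vertices.\<close>

lemma card_triangle_copies:
  assumes "simple_graph G"
  shows "card (copies (cycle_graph 3) G) = card (triangles (edges G))"
proof (rule bij_betw_same_card[of verts], rule bij_betw_imageI)
  have three: "{..<3} = {0, 1, 2::nat}" by auto
  have mods: "Suc 0 mod 3 = 1" "Suc 1 mod 3 = 2" "Suc 2 mod 3 = 0" by simp_all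
  have image3: "f ` {..<3} = {f 0, f 1, f 2}"
    "(\<lambda>i. {f i, f (Suc i mod 3)}) ` {..<3} = {{f 0, f 1}, {f 1, f 2}, {f 0, f 2}}" for f :: "nat \<Rightarrow> 'a"
    unfolding three image_insert image_empty mods by auto
  have inj3: "inj_on f {..<3} \<longleftrightarrow> f 0 \<noteq> f 1 \<and> f 1 \<noteq> f 2 \<and> f 0 \<noteq> f 2" for f :: "nat \<Rightarrow> 'a"
    unfolding three by (auto simp: inj_on_def)
  have all3: "(\<forall>i<3. P i) \<longleftrightarrow> P 0 \<and> P 1 \<and> P (2::nat)" for P
    using three by (metis insert_iff lessThan_iff empty_iff)
  have cycle_in_3: "cycle_in (edges G) 3 f \<and> S = (f ` {..<3}, (\<lambda>i. {f i, f (Suc i mod 3)}) ` {..<3}) \<longleftrightarrow>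
     f 0 \<noteq> f 1 \<and> f 1 \<noteq> f 2 \<and> f 0 \<noteq> f 2 \<and> {f 0, f 1} \<in> edges G \<and> {f 1, f 2} \<in> edges G
        \<and> {f 0, f 2} \<in> edges G \<and> S = ({f 0, f 1, f 2}, {{f 0, f 1}, {f 1, f 2}, {f 0, f 2}})" for f S
  proof -
    have "{f 2, f 0} = {f 0, f 2}" by blast
    then show ?thesis
      unfolding cycle_in_def inj3 all3 image3 mods by (simp only: conj_assoc)
  qed
  have copy: "S \<in> copies (cycle_graph 3) G \<longleftrightarrow>
     (\<exists>a b c. a \<noteq> b \<and> b \<noteq> c \<and> a \<noteq> c \<and> {a, b} \<in> edges G \<and> {b, c} \<in> edges G \<and> {a, c} \<in> edges G
       \<and> S = ({a, b, c}, {{a, b}, {b, c}, {a, c}}))" (is "_ \<longleftrightarrow> ?R") for S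
  proof -
    have "S \<in> copies (cycle_graph 3) G \<longleftrightarrow>
      (\<exists>f. f 0 \<noteq> f 1 \<and> f 1 \<noteq> f (2::nat) \<and> f 0 \<noteq> f 2 \<and> {f 0, f 1} \<in> edges G \<and> {f 1, f 2} \<in> edges G
        \<and> {f 0, f 2} \<in> edges G \<and> S = ({f 0, f 1, f 2}, {{f 0, f 1}, {f 1, f 2}, {f 0, f 2}}))"
      unfolding copy_cycle_iff[OF assms zero_less_numeral] cycle_in_3 ..
    also have "\<dots> \<longleftrightarrow> ?R"
    proof
      assume ?R
      then obtain a b c where abc: "a \<noteq> b \<and> b \<noteq> c \<and> a \<noteq> c \<and> {a, b} \<in> edges G \<and> {b, c} \<in> edges G \<and> {a, c} \<in> edges G
       \<and> S = ({a, b, c}, {{a, b}, {b, c}, {a, c}})" by blast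
      let ?f = "\<lambda>i::nat. if i = 0 then a else if i = 1 then b else c"
      show "\<exists>f. f 0 \<noteq> f 1 \<and> f 1 \<noteq> f (2::nat) \<and> f 0 \<noteq> f 2 \<and> {f 0, f 1} \<in> edges G \<and> {f 1, f 2} \<in> edges G
        \<and> {f 0, f 2} \<in> edges G \<and> S = ({f 0, f 1, f 2}, {{f 0, f 1}, {f 1, f 2}, {f 0, f 2}})"
        by (rule exI[of _ ?f]) (use abc in simp)
    qed blast
    finally show ?thesis .
  qed
  have edges_eq: "edges S = {e. e \<subseteq> verts S \<and> card e = 2}" if "S \<in> copies (cycle_graph 3) G" for S
  proof -
    obtain a b c where abc: "a \<noteq> b" "b \<noteq> c" "a \<noteq> c" and S: "S = ({a, b, c}, {{a, b}, {b, c}, {a, c}})"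
      using \<open>S \<in> _\<close> unfolding copy by blast
    have "e \<in> {{a, b}, {b, c}, {a, c}}" if "e \<subseteq> {a, b, c}" "card e = 2" for e
    proof -
      obtain x y where "e = {x, y}" "x \<noteq> y" using \<open>card e = 2\<close> by (auto simp: card_2_iff)
      with that show ?thesis by auto
    qed
    moreover have "e \<subseteq> {a, b, c}" "card e = 2" if "e \<in> {{a, b}, {b, c}, {a, c}}" for e
      using that abc by auto
    ultimately show ?thesis unfolding S fst_conv snd_conv by blast
  qed
  show "inj_on verts (copies (cycle_graph 3) G)"
  proof (rule inj_onI)
    fix S S' assume S: "S \<in> copies (cycle_graph 3) G" "S' \<in> copies (cycle_graph 3) G" "verts S = verts S'"
    then have "edges S = edges S'" by (simp add: edges_eq)
    with S(3) show "S = S'" by (rule prod_eqI)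
  qed
  show "verts ` copies (cycle_graph 3) G = triangles (edges G)"
  proof (intro equalityI subsetI)
    fix T assume "T \<in> triangles (edges G)"
    then obtain a b c where "a \<noteq> b" "b \<noteq> c" "a \<noteq> c" "{a, b} \<in> edges G" "{b, c} \<in> edges G" "{a, c} \<in> edges G"
      and T: "T = {a, b, c}" unfolding triangles_def by blast
    then have "({a, b, c}, {{a, b}, {b, c}, {a, c}}) \<in> copies (cycle_graph 3) G"
      unfolding copy by blast
    then show "T \<in> verts ` copies (cycle_graph 3) G"
      by (rule rev_image_eqI) (simp add: T)
  next
    fix T assume "T \<in> verts ` copies (cycle_graph 3) G"
    then obtain S where S: "S \<in> copies (cycle_graph 3) G" "T = verts S" by blast
    from S(1) obtain a b c where "a \<noteq> b" "b \<noteq> c" "a \<noteq> c" "{a, b} \<in> edges G" "{b, c} \<in> edges G" "{a, c} \<in> edges G"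
      and "S = ({a, b, c}, {{a, b}, {b, c}, {a, c}})" unfolding copy by blast
    with S(2) show "T \<in> triangles (edges G)"
      by (simp add: trianglesI)
  qed
qed

section \<open>From constructions to bounds on the extremal numbers\<close>

lemma finite_edges: "simple_graph G \<Longrightarrow> finite (edges G)"
  by (rule finite_subset[OF edges_subset_Pow]) (simp_all add: simple_graph_def)

lemma triangles_subset_Pow: "simple_graph G \<Longrightarrow> triangles (edges G) \<subseteq> Pow (verts G)"
  by (fastforce simp: simple_graph_def elim!: trianglesE)

lemma finite_triangles: "simple_graph G \<Longrightarrow> finite (triangles (edges G))"
  by (rule finite_subset[OF triangles_subset_Pow]) (simp_all add: simple_graph_def)

text \<open>The constructions have vertices of convenient types and at most n of them, whereas the
  extremal numbers range over graphs on exactly n naturals. Isolated vertices fill the gap, and the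
  map \<open>r\<close> back to \<open>G\<close> carries cycles and colours across.\<close>

lemma embed_in_nat_graph:
  fixes G :: "'a ugraph"
  assumes G: "simple_graph G" and n: "card (verts G) \<le> n"
  obtains G' :: "nat ugraph" and r where "n_vertex_graph n G'" "inj_on r (\<Union>(edges G'))"
    "\<And>e. e \<in> edges G' \<Longrightarrow> r ` e \<in> edges G"
    "card (triangles (edges G)) \<le> card (triangles (edges G'))"
proof -
  have fin: "finite (verts G)" using G by (simp add: simple_graph_def)
  obtain g where g: "inj_on g (verts G)" "g ` verts G \<subseteq> {..<n}"
    using card_le_inj[OF fin, of "{..<n}"] n by auto
  have sub: "e \<subseteq> verts G" "card e = 2" if "e \<in> edges G" for e
    using G that by (auto simp: simple_graph_def)
  define r where "r = inv_into (verts G) g"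
  define G' where "G' = ({..<n}, (\<lambda>e. g ` e) ` edges G)"
  have rg: "r ` (g ` e) = e" if "e \<in> edges G" for e
    unfolding r_def using g(1) sub[OF that] by (metis inv_into_image_cancel)
  have card_g: "card (g ` e) = 2" if "e \<in> edges G" for e
    using sub[OF that] g(1) by (metis card_image inj_on_subset)
  have simple: "n_vertex_graph n G'"
    using g sub card_g by (fastforce simp: n_vertex_graph_def simple_graph_def G'_def)
  have "inj_on r (g ` verts G)"
    unfolding r_def by (rule inj_on_inv_into) simp
  then have inj: "inj_on r (\<Union>(edges G'))"
    by (rule inj_on_subset) (use sub in \<open>auto simp: G'_def\<close>)
  have "(\<lambda>T. g ` T) ` triangles (edges G) \<subseteq> triangles (edges G')"
  proof clarify
    fix T assume "T \<in> triangles (edges G)"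
    then obtain a b c where T: "T = {a, b, c}" "a \<noteq> b" "b \<noteq> c" "a \<noteq> c"
      "{a, b} \<in> edges G" "{b, c} \<in> edges G" "{a, c} \<in> edges G" by (elim trianglesE)
    have "g a \<noteq> g b" "g b \<noteq> g c" "g a \<noteq> g c"
      using T(2-4) sub(1)[OF T(5)] sub(1)[OF T(6)] inj_on_eq_iff[OF g(1)] by auto
    moreover have "{g a, g b} \<in> edges G'" "{g b, g c} \<in> edges G'" "{g a, g c} \<in> edges G'"
      using imageI[OF T(5), of "(`) g"] imageI[OF T(6), of "(`) g"] imageI[OF T(7), of "(`) g"]
      by (simp_all add: G'_def)
    ultimately show "g ` T \<in> triangles (edges G')"
      by (simp add: T(1) trianglesI)
  qed
  moreover have "inj_on (\<lambda>T. g ` T) (triangles (edges G))"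
  proof (rule inj_on_subset[of _ "Pow (verts G)"])
    show "inj_on ((`) g) (Pow (verts G))" by (rule inj_on_image_Pow[OF g(1)])
    show "triangles (edges G) \<subseteq> Pow (verts G)" by (rule triangles_subset_Pow[OF G])
  qed
  moreover have "finite (triangles (edges G'))"
    using simple by (intro finite_triangles) (simp add: n_vertex_graph_def)
  ultimately have "card (triangles (edges G)) \<le> card (triangles (edges G'))"
    by (intro card_inj_on_le)
  with simple inj show ?thesis
    by (intro that[of G' r]) (auto simp: G'_def rg)
qed

lemma cycle_in_image:
  assumes "cycle_in E' m f" "inj_on r (\<Union>E')" "\<And>e. e \<in> E' \<Longrightarrow> r ` e \<in> E"
  shows "cycle_in E m (r \<circ> f)"
proof -
  have "f i \<in> \<Union>E'" if "i < m" for i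
    using assms(1) that by (auto simp: cycle_in_def)
  then have "inj_on (r \<circ> f) {..<m}"
    using assms(1,2) by (intro comp_inj_on) (auto simp: cycle_in_def intro: inj_on_subset)
  moreover have "r ` {f i, f (Suc i mod m)} \<in> E" if "i < m" for i
    using assms(1,3) that unfolding cycle_in_def by blast
  ultimately show ?thesis
    by (simp add: cycle_in_def)
qed

lemma ex_copies_rainbow_ge:
  fixes G :: "'a ugraph" and c :: "'a set \<Rightarrow> 'c"
  assumes G: "simple_graph G" "card (verts G) \<le> n" and m: "m \<ge> 3"
    and proper: "\<And>e e'. e \<in> edges G \<Longrightarrow> e' \<in> edges G \<Longrightarrow> e \<noteq> e' \<Longrightarrow> e \<inter> e' \<noteq> {} \<Longrightarrow> c e \<noteq> c e'"
    and no_rainbow: "\<And>f. cycle_in (edges G) m f \<Longrightarrow> \<not> inj_on (\<lambda>i. c {f i, f (Suc i mod m)}) {..<m}"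
  shows "card (triangles (edges G)) \<le> ex_copies_rainbow n (cycle_graph 3) (cycle_graph m)"
proof -
  obtain G' r where G': "n_vertex_graph n G'" and r: "inj_on r (\<Union>(edges G'))"
    "\<And>e. e \<in> edges G' \<Longrightarrow> r ` e \<in> edges G"
    and tri: "card (triangles (edges G)) \<le> card (triangles (edges G'))"
    using embed_in_nat_graph[OF G] by metis
  have simple: "simple_graph G'" using G' by (simp add: n_vertex_graph_def)
  \<comment> \<open>Only finitely many colours occur, so colours of any type can be recoded as
    naturals.\<close>
  obtain \<phi> :: "'c \<Rightarrow> nat" where \<phi>: "inj_on \<phi> (c ` edges G)"
    using finite_imp_inj_to_nat_seg[of "c ` edges G"] finite_edges[OF G(1)] by auto
  define c' where "c' e = \<phi> (c (r ` e))" for e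
  have "proper_edge_colouring G' c'"
    unfolding proper_edge_colouring_def
  proof (intro ballI impI, elim conjE)
    fix e e' assume e: "e \<in> edges G'" "e' \<in> edges G'" "e \<noteq> e'" "e \<inter> e' \<noteq> {}"
    have "r ` e \<noteq> r ` e'"
      using e r(1) by (metis Union_upper inj_on_image_eq_iff)
    moreover have "r ` e \<inter> r ` e' \<noteq> {}" using e by blast
    ultimately have "c (r ` e) \<noteq> c (r ` e')" by (rule proper[OF r(2)[OF e(1)] r(2)[OF e(2)]])
    then show "c' e \<noteq> c' e'"
      using r(2) e(1,2) inj_on_eq_iff[OF \<phi>] by (simp add: c'_def)
  qed
  moreover have "rainbow_free_of (cycle_graph m) G' c'"
    unfolding rainbow_free_of_cycle_iff[OF simple m]
  proof clarify
    fix f assume f: "cycle_in (edges G') m f" "inj_on (\<lambda>i. c' {f i, f (Suc i mod m)}) {..<m}"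
    have "cycle_in (edges G) m (r \<circ> f)" using cycle_in_image[OF f(1) r] .
    moreover have "inj_on (\<lambda>i. c {(r \<circ> f) i, (r \<circ> f) (Suc i mod m)}) {..<m}"
      using f(2) by (auto simp: inj_on_def c'_def)
    ultimately show False using no_rainbow by blast
  qed
  ultimately have "card (copies (cycle_graph 3) G') \<le> ex_copies_rainbow n (cycle_graph 3) (cycle_graph m)"
    unfolding ex_copies_rainbow_def
    by (intro Max_ge[OF finite_copy_counts]) (use G' in blast)
  with tri show ?thesis by (simp add: card_triangle_copies[OF simple])
qed

lemma ex_copies_ge_nat:
  assumes "n_vertex_graph n G" "free_of F G"
  shows "card (copies H G) \<le> ex_copies n H F"
  unfolding ex_copies_def
proof (rule Max_ge)
  show "finite {card (copies H G) | G. n_vertex_graph n G \<and> free_of F G}"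
    using finite_copy_counts[of H n "\<lambda>G _. free_of F G"] by simp
  show "card (copies H G) \<in> {card (copies H G) | G. n_vertex_graph n G \<and> free_of F G}"
    using assms by blast
qed

lemma ex_copies_ge:
  fixes G :: "'a ugraph"
  assumes G: "simple_graph G" "card (verts G) \<le> n" and m: "m > 0"
    and free: "\<nexists>f. cycle_in (edges G) m f"
  shows "card (triangles (edges G)) \<le> ex_copies n (cycle_graph 3) (cycle_graph m)"
proof -
  obtain G' r where G': "n_vertex_graph n G'" and r: "inj_on r (\<Union>(edges G'))"
    "\<And>e. e \<in> edges G' \<Longrightarrow> r ` e \<in> edges G"
    and tri: "card (triangles (edges G)) \<le> card (triangles (edges G'))"
    using embed_in_nat_graph[OF G] by metis
  have simple: "simple_graph G'" using G' by (simp add: n_vertex_graph_def)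
  have "free_of (cycle_graph m) G'"
    using free cycle_in_image[OF _ r] unfolding free_of_cycle_iff[OF simple m] by blast
  from tri ex_copies_ge_nat[OF G' this, of "cycle_graph 3"] show ?thesis
    by (simp add: card_triangle_copies[OF simple])
qed

lemma ex_copies_attained:
  assumes "edges F \<noteq> {}"
  obtains G where "n_vertex_graph n G" "free_of F G" "card (copies H G) = ex_copies n H F"
proof -
  let ?A = "{card (copies H G) | G. n_vertex_graph n G \<and> free_of F G}"
  have "finite ?A" using finite_copy_counts[of H n "\<lambda>G _. free_of F G"] by simp
  moreover have "card (copies H ({..<n}, {})) \<in> ?A"
    using empty_graph_admissible(1,2)[OF assms] by (intro CollectI exI[of _ "({..<n}, {})"] conjI refl)
  ultimately have "Max ?A \<in> ?A" by (intro Max_in) auto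
  then obtain G where G: "Max ?A = card (copies H G)" "n_vertex_graph n G" "free_of F G"
    by (elim CollectE exE conjE)
  show ?thesis by (rule that[OF G(2,3)]) (simp only: ex_copies_def G(1))
qed

lemma ex_copies_rainbow_attained:
  assumes "edges F \<noteq> {}"
  obtains G c where "n_vertex_graph n G" "proper_edge_colouring G c" "rainbow_free_of F G c"
    "card (copies H G) = ex_copies_rainbow n H F"
proof -
  let ?A = "{card (copies H G) | G c.
      n_vertex_graph n G \<and> proper_edge_colouring G c \<and> rainbow_free_of F G c}"
  have "card (copies H ({..<n}, {})) \<in> ?A"
    using empty_graph_admissible(1,3,4)[OF assms]
    by (intro CollectI exI[of _ "({..<n}, {})"] exI[of _ "\<lambda>_. 0"] conjI refl)
  then have "Max ?A \<in> ?A" by (intro Max_in[OF finite_copy_counts]) auto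
  then obtain G c where G: "Max ?A = card (copies H G)" "n_vertex_graph n G"
      "proper_edge_colouring G c" "rainbow_free_of F G c"
    by (elim CollectE exE conjE)
  show ?thesis by (rule that[OF G(2-4)]) (simp only: ex_copies_rainbow_def G(1))
qed

lemma ex_family_attained:
  assumes "\<And>F. F \<in> \<F> \<Longrightarrow> edges F \<noteq> {}"
  obtains G where "n_vertex_graph n G" "\<forall>F\<in>\<F>. free_of F G" "card (edges G) = ex_family n \<F>"
proof -
  let ?A = "{card (edges G) | G. n_vertex_graph n G \<and> (\<forall>F \<in> \<F>. free_of F G)}"
  have "finite ?A" using finite_edge_counts[of n "\<lambda>G _. \<forall>F \<in> \<F>. free_of F G"] by simp
  moreover have "n_vertex_graph n ({..<n}, {})" by (simp add: n_vertex_graph_def simple_graph_def)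
  then have "card (edges ({..<n}, {})) \<in> ?A"
    using empty_graph_admissible(2)[OF assms] by (intro CollectI exI[of _ "({..<n}, {})"] conjI refl ballI)
  ultimately have "Max ?A \<in> ?A" by (intro Max_in) auto
  then obtain G where G: "Max ?A = card (edges G)" "n_vertex_graph n G" "\<forall>F \<in> \<F>. free_of F G"
    by (elim CollectE exE conjE)
  show ?thesis by (rule that[OF G(2,3)]) (simp only: ex_family_def G(1))
qed

lemma ex_star_ge:
  assumes "n_vertex_graph n G" "proper_edge_colouring G c" "rainbow_free_of F G c"
  shows "card (edges G) \<le> ex_star n F"
  unfolding ex_star_def
  by (rule Max_ge[OF finite_edge_counts]) (use assms in blast)

text \<open>A graph without F has no rainbow F under any colouring, and giving all edges different
  colours is a proper colouring.\<close>

lemma ex_copies_le_ex_copies_rainbow: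
  assumes "edges F \<noteq> {}"
  shows "ex_copies n H F \<le> ex_copies_rainbow n H F"
proof -
  obtain G where G: "n_vertex_graph n G" "free_of F G" "card (copies H G) = ex_copies n H F"
    using ex_copies_attained[OF assms] by metis
  obtain c :: "nat set \<Rightarrow> nat" where c: "inj_on c (edges G)"
    using finite_imp_inj_to_nat_seg[OF finite_edges, of G] G(1) by (auto simp: n_vertex_graph_def)
  have "proper_edge_colouring G c"
    using c by (auto simp: proper_edge_colouring_def dest: inj_onD)
  moreover have "rainbow_free_of F G c"
    using G(2) by (simp add: rainbow_free_of_def free_of_def)
  ultimately show ?thesis
    unfolding ex_copies_rainbow_def G(3)[symmetric]
    by (intro Max_ge[OF finite_copy_counts]) (use G in blast)
qed

section \<open>Triangles and edges in properly coloured graphs\<close>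

definition nbrs :: "'a set set \<Rightarrow> 'a \<Rightarrow> 'a set" where
  "nbrs E v = {w. {v, w} \<in> E}"

lemma nbrs_subset: "simple_graph G \<Longrightarrow> nbrs (edges G) v \<subseteq> verts G"
  by (auto simp: nbrs_def simple_graph_def)

lemma finite_nbrs: "simple_graph G \<Longrightarrow> finite (nbrs (edges G) v)"
  by (rule finite_subset[OF nbrs_subset]) (simp_all add: simple_graph_def)

lemma singleton_notin_edges: "simple_graph G \<Longrightarrow> {v} \<notin> edges G"
  by (auto simp: simple_graph_def)

lemma edgeE:
  assumes "simple_graph G" "e \<in> edges G"
  obtains a b where "e = {a, b}" "a \<noteq> b" "a \<in> verts G" "b \<in> verts G"
proof -
  have "card e = 2" "e \<subseteq> verts G" using assms by (auto simp: simple_graph_def)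
  then show ?thesis using that by (auto simp: card_2_iff)
qed

lemma sum_card_nbrs:
  assumes "simple_graph G"
  shows "(\<Sum>v\<in>verts G. card (nbrs (edges G) v)) = 2 * card (edges G)"
proof -
  have "card (nbrs (edges G) v) = card {e \<in> edges G. v \<in> e}" for v
  proof (rule bij_betw_same_card[of "\<lambda>w. {v, w}"], rule bij_betw_imageI)
    show "inj_on (\<lambda>w. {v, w}) (nbrs (edges G) v)"
      by (auto simp: inj_on_def doubleton_eq_iff)
    show "(\<lambda>w. {v, w}) ` nbrs (edges G) v = {e \<in> edges G. v \<in> e}"
    proof (intro equalityI subsetI)
      fix e assume "e \<in> {e \<in> edges G. v \<in> e}"
      then have e: "e \<in> edges G" "v \<in> e" by auto
      then obtain w where "e = {v, w}" using edgeE[OF assms e(1)] by blast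
      with e show "e \<in> (\<lambda>w. {v, w}) ` nbrs (edges G) v" by (auto simp: nbrs_def)
    qed (auto simp: nbrs_def)
  qed
  then have "(\<Sum>v\<in>verts G. card (nbrs (edges G) v)) = (\<Sum>v\<in>verts G. card {e \<in> edges G. v \<in> e})"
    by simp
  also have "\<dots> = 2 * card (edges G)"
  proof (rule sum_multicount)
    show "finite (verts G)" using assms by (simp add: simple_graph_def)
    show "finite (edges G)" using assms by (rule finite_edges)
    show "\<forall>e\<in>edges G. card {v \<in> verts G. v \<in> e} = 2"
    proof
      fix e assume "e \<in> edges G"
      then have "{v \<in> verts G. v \<in> e} = e" "card e = 2" using assms by (auto simp: simple_graph_def)
      then show "card {v \<in> verts G. v \<in> e} = 2" by simp
    qed
  qed
  finally show ?thesis .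
qed

text \<open>A triangle through v is v together with an edge inside the neighbourhood of v. The sum
  sees it from each of its vertices, which only increases the right-hand side.\<close>

lemma card_triangles_le_links:
  assumes "simple_graph G"
  shows "card (triangles (edges G)) \<le> (\<Sum>v\<in>verts G. card {e \<in> edges G. e \<subseteq> nbrs (edges G) v})"
proof -
  let ?L = "\<lambda>v. {e \<in> edges G. e \<subseteq> nbrs (edges G) v}"
  have fin: "finite (verts G)" "finite (?L v)" for v
    using assms finite_edges[OF assms] by (auto simp: simple_graph_def)
  have "triangles (edges G) \<subseteq> (\<lambda>(v, e). insert v e) ` (SIGMA v:verts G. ?L v)"
  proof
    fix T assume "T \<in> triangles (edges G)"
    then obtain a b c where T: "T = {a, b, c}" "{a, b} \<in> edges G" "{b, c} \<in> edges G" "{a, c} \<in> edges G"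
      by (elim trianglesE)
    then have "(a, {b, c}) \<in> (SIGMA v:verts G. ?L v)"
      using assms by (auto simp: nbrs_def simple_graph_def)
    then show "T \<in> (\<lambda>(v, e). insert v e) ` (SIGMA v:verts G. ?L v)"
      by (rule rev_image_eqI) (simp add: T)
  qed
  then have "card (triangles (edges G)) \<le> card (SIGMA v:verts G. ?L v)"
    using fin by (meson surj_card_le finite_SigmaI)
  then show ?thesis using fin by (simp add: card_SigmaI)
qed

context
  fixes G :: "'a ugraph" and c :: "'a set \<Rightarrow> nat"
  assumes G: "simple_graph G" and proper: "proper_edge_colouring G c"
begin

lemma colour_eqD: "{a, b} \<in> edges G \<Longrightarrow> {a, b'} \<in> edges G \<Longrightarrow> c {a, b} = c {a, b'} \<Longrightarrow> b = b'"
  using proper unfolding proper_edge_colouring_def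
  by (metis Int_iff doubleton_eq_iff empty_iff insertI1)

lemma card_nbrs_colour_le:
  assumes "finite K"
  shows "card {w \<in> nbrs (edges G) u. c {u, w} \<in> K} \<le> card K"
proof (rule card_inj_on_le[of "\<lambda>w. c {u, w}"])
  show "inj_on (\<lambda>w. c {u, w}) {w \<in> nbrs (edges G) u. c {u, w} \<in> K}"
    by (rule inj_onI) (auto simp: nbrs_def dest: colour_eqD)
qed (use assms in auto)

text \<open>The colour of the edge from the end of the path back to its start is controlled along the way,
  except against the first edge, where properness takes care of it.\<close>

lemma rainbow_path_in_link:
  assumes S: "S \<subseteq> nbrs (edges G) v" "S \<noteq> {}"
    and deg: "\<And>u. u \<in> S \<Longrightarrow> card (nbrs (edges G) u \<inter> S) > 3 * l"
    and j: "1 \<le> j" "j \<le> l"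
  shows "\<exists>f. f 0 = v \<and> (\<forall>i\<in>{1..j}. f i \<in> S) \<and> inj_on f {..j} \<and> (\<forall>i<j. {f i, f (Suc i)} \<in> edges G)
      \<and> inj_on (\<lambda>i. c {f i, f (Suc i)}) {..<j} \<and> c {v, f j} \<notin> (\<lambda>i. c {f i, f (Suc i)}) ` {1..<j}"
  using j
proof (induction j rule: dec_induct)
  case base
  obtain u where u: "u \<in> S" using S(2) by blast
  have "u \<noteq> v" using u S(1) singleton_notin_edges[OF G] by (auto simp: nbrs_def)
  then show ?case
    using u S(1) by (intro exI[of _ "\<lambda>i. if i = 0 then v else u"]) (auto simp: nbrs_def inj_on_def le_Suc_eq)
next
  case (step j)
  then obtain f where f: "f 0 = v" "\<And>i. i \<in> {1..j} \<Longrightarrow> f i \<in> S" "inj_on f {..j}"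
    "\<And>i. i < j \<Longrightarrow> {f i, f (Suc i)} \<in> edges G"
    and rb: "inj_on (\<lambda>i. c {f i, f (Suc i)}) {..<j}"
    and close: "c {v, f j} \<notin> (\<lambda>i. c {f i, f (Suc i)}) ` {1..<j}"
    by auto
  let ?u = "f j"
  let ?K = "(\<lambda>i. c {f i, f (Suc i)}) ` {..<j}"
  \<comment> \<open>The next vertex has to avoid the j + 1 vertices of the path, the at most j
    neighbours of its end along a used colour, and the at most j neighbours of v whose edge to v has
    a used colour. These are at most 3j + 1 \<le> 3l vertices, which explains the degree
    condition.\<close>
  let ?bad = "f ` {..j} \<union> {w \<in> nbrs (edges G) ?u. c {?u, w} \<in> ?K} \<union> {w \<in> nbrs (edges G) v. c {v, w} \<in> ?K}"
  have u: "?u \<in> S" using f(2) step by simp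
  have K: "card ?K \<le> j" using card_image_le[of "{..<j}"] by auto
  have "card (f ` {..j}) \<le> Suc j" using card_image_le[of "{..j}" f] by simp
  moreover have "card {w \<in> nbrs (edges G) ?u. c {?u, w} \<in> ?K} \<le> j"
    "card {w \<in> nbrs (edges G) v. c {v, w} \<in> ?K} \<le> j"
    using card_nbrs_colour_le[of ?K] K by (meson finite_imageI finite_lessThan le_trans)+
  ultimately have "card ?bad \<le> Suc j + j + j"
    by (meson add_mono card_Un_le le_trans)
  also have "\<dots> \<le> 3 * l" using step by simp
  also have "\<dots> < card (nbrs (edges G) ?u \<inter> S)" by (rule deg[OF u])
  finally have less: "card ?bad < card (nbrs (edges G) ?u \<inter> S)" .
  have "finite ?bad" using finite_nbrs[OF G] by auto
  with less have "\<not> nbrs (edges G) ?u \<inter> S \<subseteq> ?bad"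
    by (meson card_mono not_le)
  then obtain w where w: "w \<in> nbrs (edges G) ?u" "w \<in> S" "w \<notin> ?bad" by blast
  have w_new: "w \<notin> f ` {..j}" and cu: "c {?u, w} \<notin> ?K" and cv: "c {v, w} \<notin> ?K"
    using w S(1) by auto
  have vw: "{v, w} \<in> edges G" and uw: "{?u, w} \<in> edges G"
    using w S(1) by (auto simp: nbrs_def)
  \<comment> \<open>The new path edge and the new closing edge meet in w, so properness separates
    their colours.\<close>
  have "f j \<noteq> f 0" using f(3) step by (auto simp: inj_on_eq_iff)
  then have "c {v, w} \<noteq> c {?u, w}"
    using colour_eqD[of w v ?u] vw uw f(1) by (auto simp: insert_commute)
  define g where "g = f(Suc j := w)"
  have g: "g i = f i" if "i \<le> j" for i using that by (simp add: g_def)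
  have gw: "g (Suc j) = w" by (simp add: g_def)
  have col: "c {g i, g (Suc i)} = c {f i, f (Suc i)}" if "i < j" for i using that g by simp
  have colj: "c {g j, g (Suc j)} = c {?u, w}" using g gw by simp
  have img: "(\<lambda>i. c {g i, g (Suc i)}) ` {..<j} = ?K" using col by (auto intro!: image_cong)
  show ?case
  proof (intro exI[of _ g] conjI)
    show "g 0 = v" using f(1) g by simp
    show "\<forall>i\<in>{1..Suc j}. g i \<in> S" using f(2) w(2) g gw by (auto simp: le_Suc_eq)
    have "inj_on g {..j}" using f(3) g by (simp add: inj_on_def)
    then show "inj_on g {..Suc j}"
      using w_new g gw by (auto simp: atMost_Suc image_iff)
    show "\<forall>i<Suc j. {g i, g (Suc i)} \<in> edges G"
      using f(4) uw g gw by (auto simp: less_Suc_eq)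
    have "inj_on (\<lambda>i. c {g i, g (Suc i)}) {..<j}"
      using rb col by (simp add: inj_on_def)
    then show "inj_on (\<lambda>i. c {g i, g (Suc i)}) {..<Suc j}"
      using cu colj img by (simp add: lessThan_Suc)
    show "c {v, g (Suc j)} \<notin> (\<lambda>i. c {g i, g (Suc i)}) ` {1..<Suc j}"
    proof
      assume "c {v, g (Suc j)} \<in> (\<lambda>i. c {g i, g (Suc i)}) ` {1..<Suc j}"
      then obtain i where i: "i < Suc j" "c {v, w} = c {g i, g (Suc i)}" using gw by auto
      show False
      proof (cases "i = j")
        case True
        then show False using i colj \<open>c {v, w} \<noteq> c {?u, w}\<close> by simp
      next
        case False
        then show False using i img cv by auto
      qed
    qed
  qed
qed

text \<open>Degeneracy argument: removing a vertex with at most 3l neighbours in \<open>S\<close>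
  costs at most 3l edges. When no such vertex is left in a nonempty set, a rainbow path with l edges
  runs from v into the set and closes up to a rainbow cycle of length l + 1.\<close>

lemma card_link_edges_le:
  assumes rf: "rainbow_free_of (cycle_graph (Suc l)) G c" and l: "l \<ge> 2"
    and S: "S \<subseteq> nbrs (edges G) v"
  shows "card {e \<in> edges G. e \<subseteq> S} \<le> 3 * l * card S"
proof -
  have "finite S" using S finite_nbrs[OF G] finite_subset by blast
  then show ?thesis using S
  proof (induction "card S" arbitrary: S rule: less_induct)
    case less
    show ?case
    proof (cases "\<exists>u\<in>S. card (nbrs (edges G) u \<inter> S) \<le> 3 * l")
      case True
      then obtain u where u: "u \<in> S" "card (nbrs (edges G) u \<inter> S) \<le> 3 * l" by blast
      let ?S = "S - {u}"
      have IH: "card {e \<in> edges G. e \<subseteq> ?S} \<le> 3 * l * card ?S"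
        using less.prems u(1) card_Diff1_less[of S u] by (intro less.hyps) auto
      have "{e \<in> edges G. e \<subseteq> S} \<subseteq> {e \<in> edges G. e \<subseteq> ?S} \<union> (\<lambda>w. {u, w}) ` (nbrs (edges G) u \<inter> S)"
      proof
        fix e assume e: "e \<in> {e \<in> edges G. e \<subseteq> S}"
        show "e \<in> {e \<in> edges G. e \<subseteq> ?S} \<union> (\<lambda>w. {u, w}) ` (nbrs (edges G) u \<inter> S)"
        proof (cases "u \<in> e")
          case True
          obtain a b where "e = {a, b}" using e edgeE[OF G, of e] by blast
          with True obtain w where "e = {u, w}" by auto
          with e show ?thesis by (auto simp: nbrs_def)
        qed (use e in blast)
      qed
      then have "card {e \<in> edges G. e \<subseteq> S} \<le> card ({e \<in> edges G. e \<subseteq> ?S} \<union> (\<lambda>w. {u, w}) ` (nbrs (edges G) u \<inter> S))"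
        using finite_edges[OF G] finite_nbrs[OF G] by (intro card_mono) auto
      also have "\<dots> \<le> card {e \<in> edges G. e \<subseteq> ?S} + card ((\<lambda>w. {u, w}) ` (nbrs (edges G) u \<inter> S))"
        by (rule card_Un_le)
      also have "\<dots> \<le> 3 * l * card ?S + 3 * l"
        using IH u(2) card_image_le[of "nbrs (edges G) u \<inter> S" "\<lambda>w. {u, w}"] finite_nbrs[OF G, of u] by fastforce
      also have "\<dots> = 3 * l * card S"
        using u(1) less.prems(1) by (metis add.commute card.remove mult_Suc_right)
      finally show ?thesis .
    next
      case False
      show ?thesis
      proof (cases "S = {}")
        case True
        then have "{e \<in> edges G. e \<subseteq> S} = {}" using G by (auto simp: simple_graph_def)
        then show ?thesis by (simp only: card.empty le0)
      next
        case nonempty: False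
        obtain f where f: "f 0 = v" "\<forall>i\<in>{1..l}. f i \<in> S" "inj_on f {..l}" "\<forall>i<l. {f i, f (Suc i)} \<in> edges G"
          and rb: "inj_on (\<lambda>i. c {f i, f (Suc i)}) {..<l}"
          and close: "c {v, f l} \<notin> (\<lambda>i. c {f i, f (Suc i)}) ` {1..<l}"
          using rainbow_path_in_link[OF less.prems(2) nonempty, of l l] False l by (auto simp: not_le)
        have mod: "Suc i mod Suc l = (if i = l then 0 else Suc i)" if "i \<le> l" for i
          using that by auto
        have S: "{v, w} \<in> edges G" if "w \<in> S" for w
          using that less.prems(2) by (auto simp: nbrs_def)
        have "cycle_in (edges G) (Suc l) f"
          unfolding cycle_in_def
        proof (intro conjI allI impI)
          show "inj_on f {..<Suc l}" using f(3) by (simp add: lessThan_Suc_atMost)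
          have "f l \<in> S" using f(2) l by simp
          then show "{f i, f (Suc i mod Suc l)} \<in> edges G" if "i < Suc l" for i
            using that f(1,4) S[of "f l"] mod[of i] by (cases "i = l") (auto simp: insert_commute)
        qed
        moreover have "inj_on (\<lambda>i. c {f i, f (Suc i mod Suc l)}) {..<Suc l}"
        proof -
          have "inj_on (\<lambda>i. c {f i, f (Suc i mod Suc l)}) {..<l}"
            using rb by (simp add: inj_on_def mod)
          moreover have "c {f l, f (Suc l mod Suc l)} \<noteq> c {f i, f (Suc i mod Suc l)}" if "i < l" for i
          proof (cases "i = 0")
            case True
            have "f l \<noteq> f 1" using f(3) l by (auto simp: inj_on_eq_iff)
            then show ?thesis
              using colour_eqD[of v "f l" "f 1"] f(1,2) S l True by (auto simp: insert_commute)
          next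
            case False
            then have "c {f i, f (Suc i)} \<in> (\<lambda>i. c {f i, f (Suc i)}) ` {1..<l}" using that by auto
            then show ?thesis using close f(1) that by (auto simp: insert_commute)
          qed
          ultimately show ?thesis by (auto simp: lessThan_Suc)
        qed
        ultimately show ?thesis
          using rf rainbow_free_of_cycle_iff[OF G, of "Suc l" c] l by auto
      qed
    qed
  qed
qed

lemma card_triangles_le_edges:
  assumes "rainbow_free_of (cycle_graph (Suc l)) G c" "l \<ge> 2"
  shows "card (triangles (edges G)) \<le> 6 * l * card (edges G)"
proof -
  have "card (triangles (edges G)) \<le> (\<Sum>v\<in>verts G. card {e \<in> edges G. e \<subseteq> nbrs (edges G) v})"
    by (rule card_triangles_le_links[OF G])
  also have "\<dots> \<le> (\<Sum>v\<in>verts G. 3 * l * card (nbrs (edges G) v))"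
    using card_link_edges_le[OF assms subset_refl] by (rule sum_mono)
  also have "\<dots> = 6 * l * card (edges G)"
    by (simp add: sum_card_nbrs[OF G] flip: sum_distrib_left)
  finally show ?thesis .
qed

end

lemma ex_copies_rainbow_le_ex_star:
  assumes "m \<ge> 3"
  shows "ex_copies_rainbow n (cycle_graph 3) (cycle_graph m) \<le> 6 * m * ex_star n (cycle_graph m)"
proof -
  obtain l where l: "m = Suc l" "l \<ge> 2" using assms by (cases m) auto
  have "edges (cycle_graph m) \<noteq> {}"
    using l by (intro edges_cycle_graph_nonempty) simp
  then obtain G c where G: "n_vertex_graph n G" "proper_edge_colouring G c"
    "rainbow_free_of (cycle_graph m) G c"
    "card (copies (cycle_graph 3) G) = ex_copies_rainbow n (cycle_graph 3) (cycle_graph m)"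
    by (rule ex_copies_rainbow_attained)
  have simple: "simple_graph G" using G(1) by (simp add: n_vertex_graph_def)
  have "card (triangles (edges G)) \<le> 6 * l * card (edges G)"
    using card_triangles_le_edges[OF simple G(2)] G(3) l by simp
  also have "\<dots> \<le> 6 * m * ex_star n (cycle_graph m)"
    using ex_star_ge[OF G(1-3)] l by (intro mult_mono) auto
  finally show ?thesis using G(4) card_triangle_copies[OF simple] by simp
qed

section \<open>Finite fields of characteristic two\<close>

type_synonym F2bar = "bit alg_closure"

lemma CHAR_bit: "CHAR(bit) = 2"
  by (rule CHAR_eq_posI) (auto simp: less_Suc_eq numeral_2_eq_2)

lemma F2bar_two [simp]: "(2::F2bar) = 0"
  using of_nat_CHAR[where ?'a = F2bar] by (simp add: CHAR_bit)

lemma F2bar_add_self [simp]: "x + x = (0::F2bar)"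
  using F2bar_two by (metis mult_2 mult_zero_left)

lemma F2bar_add_left_self [simp]: "x + (x + y) = (y::F2bar)"
  by (simp flip: add.assoc)

lemma F2bar_uminus [simp]: "- x = (x::F2bar)"
  by (metis F2bar_add_self add_eq_0_iff)

lemma F2bar_add_eq_0_iff: "x + y = (0::F2bar) \<longleftrightarrow> x = y"
  by (metis F2bar_add_self add_left_cancel)

text \<open>The field with 2^m elements, as the fixed points of the m-th iterate of the Frobenius
  map. Inside the algebraic closure all these fields share one type, so m can vary with n.\<close>

definition GF :: "nat \<Rightarrow> F2bar set" where
  "GF m = {x. x ^ (2 ^ m) = x}"

lemma F2bar_freshman: "(x + y :: F2bar) ^ (2 ^ m) = x ^ (2 ^ m) + y ^ (2 ^ m)"
  by (rule freshmans_dream') (simp_all add: CHAR_bit)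

lemma F2bar_square_sum: "(sum f A :: F2bar)\<^sup>2 = (\<Sum>x\<in>A. (f x)\<^sup>2)"
  by (rule freshmans_dream_sum) (simp_all add: CHAR_bit)

lemma GF_closed:
  shows "0 \<in> GF m" "1 \<in> GF m"
    and "x \<in> GF m \<Longrightarrow> y \<in> GF m \<Longrightarrow> x + y \<in> GF m"
    and "x \<in> GF m \<Longrightarrow> y \<in> GF m \<Longrightarrow> x * y \<in> GF m"
    and "x \<in> GF m \<Longrightarrow> y \<in> GF m \<Longrightarrow> x / y \<in> GF m"
    and "x \<in> GF m \<Longrightarrow> x ^ j \<in> GF m"
  by (auto simp: GF_def F2bar_freshman power_mult_distrib power_divide power_0_left)
     (metis mult.commute power_mult)

text \<open>With q = 2^m, the polynomial X^q - X has derivative 1 in characteristic two and hence no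
  double root. Over an algebraically closed field it then has exactly q distinct roots.\<close>

lemma
  assumes "m > 0"
  shows card_GF: "card (GF m) = 2 ^ m" and finite_GF: "finite (GF m)"
proof -
  define q :: nat where "q = 2 ^ m"
  have q: "q > 1" using assms one_less_power[of "2::nat" m] by (simp add: q_def)
  define p :: "F2bar poly" where "p = monom 1 q - monom 1 1"
  have deg: "degree p = q"
    unfolding p_def diff_conv_add_uminus
    using q by (subst degree_add_eq_left) (auto simp: degree_monom_eq)
  have p0: "p \<noteq> 0" using deg q by auto
  have roots: "{x. poly p x = 0} = GF m"
    by (auto simp: p_def GF_def q_def poly_monom)
  have "of_nat q = (0::F2bar)"
    using assms by (simp add: q_def F2bar_two power_0_left)
  then have der: "pderiv p = 1"
    by (simp add: p_def pderiv_diff pderiv_monom monom_0 one_pCons)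
  obtain A where A: "size A = degree p" "p = smult (lead_coeff p) (\<Prod>x\<in>#A. [:-x, 1:])"
    using alg_closed_imp_factorization[OF p0] by blast
  have set_A: "set_mset A = GF m"
  proof -
    have "poly p x = 0 \<longleftrightarrow> x \<in># A" for x
      by (subst A(2)) (use p0 in \<open>auto simp: poly_prod_mset prod_mset_zero_iff image_iff simp del: F2bar_uminus\<close>)
    with roots show ?thesis by blast
  qed
  have "count A x \<le> 1" for x
  proof (rule ccontr)
    assume "\<not> ?thesis"
    then obtain B where B: "A = add_mset x (add_mset x B)"
      by (metis Suc_1 not_less_eq_eq One_nat_def count_le_replicate_mset_subset_eq mset_subset_eq_exists_conv
          replicate_mset_Suc replicate_mset_0 add_mset_add_single union_mset_add_mset_left empty_neutral(1))
    define r where "r = smult (lead_coeff p) (\<Prod>x\<in>#B. [:-x, 1:])"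
    have "p = [:-x, 1:] * ([:-x, 1:] * r)"
      unfolding r_def by (subst A(2)) (simp add: B mult_ac)
    then have "poly (pderiv p) x = 0"
      by (simp add: pderiv_mult del: F2bar_uminus mult_pCons_left)
    with der show False by simp
  qed
  then have "A = mset_set (set_mset A)"
    by (intro multiset_eqI) (metis count_mset_set' finite_set_mset One_nat_def count_eq_zero_iff le_Suc_eq le_zero_eq)
  then have "size A = card (set_mset A)"
    by (metis size_mset_set)
  with A(1) deg set_A show "card (GF m) = 2 ^ m" by (simp add: q_def)
  show "finite (GF m)" using set_A by (metis finite_set_mset)
qed

text \<open>Any \<open>2k\<close> of the vectors \<open>(x, x^3, \<dots>, x^(2k - 1))\<close> are thus linearly independent over
  the prime field: this is the designed distance of the binary BCH code. Squaring supplies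
  the even power sums.\<close>

lemma odd_power_sums_nonzero:
  fixes B :: "F2bar set"
  assumes "finite B" "B \<noteq> {}" "0 \<notin> B" "card B \<le> 2 * k"
  shows "\<exists>j<k. (\<Sum>x\<in>B. x ^ (2 * j + 1)) \<noteq> 0"
proof (rule ccontr)
  assume "\<not> ?thesis"
  then have odd: "(\<Sum>x\<in>B. x ^ (2 * j + 1)) = 0" if "j < k" for j using that by blast
  have pow: "(\<Sum>x\<in>B. x ^ i) = 0" if "1 \<le> i" "i \<le> 2 * k" for i
    using that
  proof (induction i rule: less_induct)
    case (less i)
    show ?case
    proof (cases "even i")
      case True
      then obtain l where l: "i = 2 * l" by blast
      then have "(\<Sum>x\<in>B. x ^ i) = (\<Sum>x\<in>B. x ^ l)\<^sup>2"
        by (simp add: F2bar_square_sum power_mult mult.commute)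
      with less l show ?thesis by auto
    next
      case False
      then obtain l where "i = 2 * l + 1" by (elim oddE)
      with odd[of l] less show ?thesis by auto
    qed
  qed
  obtain b where b: "b \<in> B" using assms by blast
  \<comment> \<open>P vanishes on \<open>B\<close> except at \<open>b\<close>, so its values on
    \<open>B\<close> sum to P(b), which is nonzero. The factor X removes the constant term, and the
    degree is at most 2k, so the same sum is a combination of the power sums of orders 1 to 2k, all
    of which vanish.\<close>
  define P where "P = [:0, 1:] * (\<Prod>y\<in>B - {b}. [:-y, 1:])"
  have "degree (\<Prod>y\<in>B - {b}. [:-y, 1:]) \<le> card B - 1"
    using degree_prod_sum_le[of "B - {b}" "\<lambda>y. [:-y, 1:]"] assms b by simp
  moreover have "degree P \<le> 1 + degree (\<Prod>y\<in>B - {b}. [:-y, 1:])"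
    unfolding P_def using degree_mult_le[of "[:0, 1:]" "\<Prod>y\<in>B - {b}. [:-y, 1:]"] by simp
  moreover have "card B > 0"
    using assms by (simp add: card_gt_0_iff)
  ultimately have "degree P \<le> card B" by linarith
  then have deg: "degree P \<le> 2 * k" using assms by simp
  have P: "poly P y = y * (\<Prod>z\<in>B - {b}. y - z)" for y
    by (simp add: P_def poly_prod algebra_simps del: F2bar_uminus)
  have "poly P y = 0" if "y \<in> B - {b}" for y
    using that assms by (auto simp: P)
  then have "(\<Sum>y\<in>B. poly P y) = poly P b"
    using assms b by (simp add: sum.remove)
  also have "(\<Sum>y\<in>B. poly P y) = (\<Sum>y\<in>B. \<Sum>i\<le>degree P. coeff P i * y ^ i)"
    by (simp add: poly_altdef)
  also have "\<dots> = (\<Sum>i\<le>degree P. coeff P i * (\<Sum>y\<in>B. y ^ i))"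
    by (subst sum.swap) (simp add: sum_distrib_left)
  also have "\<dots> = 0"
  proof (intro sum.neutral ballI)
    fix i assume "i \<in> {..degree P}"
    with deg pow[of i] show "coeff P i * (\<Sum>y\<in>B. y ^ i) = 0"
      by (cases "i = 0") (auto simp: P_def coeff_mult simp del: F2bar_uminus)
  qed
  finally show False using b assms by (auto simp: P)
qed

section \<open>The BCH graph\<close>

definition vec :: "nat \<Rightarrow> nat \<Rightarrow> (nat \<Rightarrow> F2bar) set" where
  "vec m k = {..<k} \<rightarrow>\<^sub>E GF m"

text \<open>Adds the column (x, x^3, ..., x^(2k-1)) of the BCH parity check matrix. The restriction
  to k coordinates keeps the result extensional, so that shifting twice by x gives back a vector of
  \<open>vec\<close> exactly.\<close>

definition shift :: "nat \<Rightarrow> (nat \<Rightarrow> F2bar) \<Rightarrow> F2bar \<Rightarrow> nat \<Rightarrow> F2bar" where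
  "shift k v x = (\<lambda>i\<in>{..<k}. v i + x ^ (2 * i + 1))"

definition spoke :: "nat \<Rightarrow> (nat \<Rightarrow> F2bar) \<Rightarrow> F2bar \<Rightarrow> nat \<Rightarrow> ((nat \<Rightarrow> F2bar) \<times> nat) set" where
  "spoke k v x t = {(v, 0), (shift k v x, t)}"

text \<open>Tag 0 marks the side that stays single; tags 1 and 2 mark the copies w' and w''. Spokes
  with x = 0 are left out because the column of 0 is the zero vector, which would spoil linear
  independence.\<close>

definition bch_graph :: "nat \<Rightarrow> nat \<Rightarrow> ((nat \<Rightarrow> F2bar) \<times> nat) ugraph" where
  "bch_graph m k = (vec m k \<times> {0, 1, 2},
     {spoke k v x t | v x t. v \<in> vec m k \<and> x \<in> GF m - {0} \<and> t \<in> {1, 2}} \<union>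
     {{(w, 1), (w, 2)} | w. w \<in> vec m k})"

text \<open>In characteristic two the sum of the coordinates at \<open>0\<close> recovers \<open>x\<close> from the edge
  \<open>spoke k v x t\<close>, and the sum of the tags recovers \<open>t\<close>; the edges joining the two copies of a
  vertex all get the colour \<open>(0, 3)\<close>.\<close>

definition bch_colour :: "((nat \<Rightarrow> F2bar) \<times> nat) set \<Rightarrow> F2bar \<times> nat" where
  "bch_colour e = (\<Sum>u\<in>e. fst u 0, \<Sum>u\<in>e. snd u)"

lemma shift_in_vec: "v \<in> vec m k \<Longrightarrow> x \<in> GF m \<Longrightarrow> shift k v x \<in> vec m k"
  by (auto simp: vec_def shift_def intro!: GF_closed)

lemma shift_shift:
  assumes "v \<in> vec m k"
  shows "shift k (shift k v x) x = v"
proof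
  fix i
  show "shift k (shift k v x) x i = v i"
    using assms PiE_arb[of v "{..<k}" "\<lambda>_. GF m" i]
    by (cases "i < k") (simp_all add: vec_def shift_def add.assoc)
qed

lemma bch_edge_cases:
  assumes "e \<in> edges (bch_graph m k)"
  obtains v x t where "e = {(v, 0), (shift k v x, t)}" "v \<in> vec m k" "x \<in> GF m" "x \<noteq> 0" "t = 1 \<or> t = 2"
    | w where "e = {(w, 1), (w, 2)}" "w \<in> vec m k"
  using assms unfolding bch_graph_def spoke_def snd_conv by blast

lemma spoke_in_edges:
  "v \<in> vec m k \<Longrightarrow> x \<in> GF m \<Longrightarrow> x \<noteq> 0 \<Longrightarrow> t = 1 \<or> t = 2 \<Longrightarrow> spoke k v x t \<in> edges (bch_graph m k)"
  unfolding bch_graph_def snd_conv by blast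

lemma bch_colour_spoke: "k > 0 \<Longrightarrow> t > 0 \<Longrightarrow> bch_colour {(v, 0), (shift k v x, t)} = (x, t)"
  by (simp add: bch_colour_def shift_def)

lemma bch_colour_pair: "bch_colour {(w, 1), (w, 2)} = (0, 3)"
  by (simp add: bch_colour_def)

text \<open>Several quantities that add up over the two ends of an edge depend on its colour alone:
  each coordinate, the number of ends with tag 0 and the number with tag 1. Around a cycle each of
  them totals twice a sum over the vertices.\<close>

lemma bch_edge_sums_aux:
  assumes "k > 0" "e \<in> edges (bch_graph m k)"
  shows "(\<forall>j<k. (\<Sum>u\<in>e. fst u j) = fst (bch_colour e) ^ (2 * j + 1)) \<and>
    (\<Sum>u\<in>e. of_bool (snd u = 0)) = (if snd (bch_colour e) = 3 then 0 else (1::nat)) \<and>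
    (\<Sum>u\<in>e. of_bool (snd u = 1)) = (if snd (bch_colour e) = 2 then 0 else (1::nat)) \<and>
    (snd (bch_colour e) \<in> {1, 2} \<and> fst (bch_colour e) \<noteq> 0 \<or> bch_colour e = (0, 3))"
  using assms(2)
proof (cases rule: bch_edge_cases)
  case (1 v x t)
  then have t: "t > 0" by auto
  have "bch_colour e = (x, t)" unfolding 1(1) by (rule bch_colour_spoke[OF assms(1) t])
  moreover have "(v, 0) \<noteq> (shift k v x, t)" using t by simp
  ultimately show ?thesis using 1 by (auto simp: shift_def)
next
  case (2 w)
  have "bch_colour e = (0, 3)" unfolding 2(1) by (rule bch_colour_pair)
  then show ?thesis using 2 by simp
qed

lemma bch_edge_sums:
  assumes "k > 0" "e \<in> edges (bch_graph m k)"
  shows "j < k \<Longrightarrow> (\<Sum>u\<in>e. fst u j) = fst (bch_colour e) ^ (2 * j + 1)"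
    and "(\<Sum>u\<in>e. of_bool (snd u = 0)) = (if snd (bch_colour e) = 3 then 0 else (1::nat))"
    and "(\<Sum>u\<in>e. of_bool (snd u = 1)) = (if snd (bch_colour e) = 2 then 0 else (1::nat))"
    and "snd (bch_colour e) \<in> {1, 2} \<and> fst (bch_colour e) \<noteq> 0 \<or> bch_colour e = (0, 3)"
  using bch_edge_sums_aux[OF assms] by simp_all

lemma finite_vec: "m > 0 \<Longrightarrow> finite (vec m k)"
  unfolding vec_def by (intro finite_PiE) (simp_all add: finite_GF)

lemma card_vec: "m > 0 \<Longrightarrow> card (vec m k) = 2 ^ (m * k)"
  unfolding vec_def by (simp add: card_PiE card_GF power_mult)

lemma simple_bch_graph: "m > 0 \<Longrightarrow> simple_graph (bch_graph m k)"
  unfolding simple_graph_def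
  by (auto simp: finite_vec shift_in_vec elim!: bch_edge_cases) (auto simp: bch_graph_def finite_vec shift_in_vec)

lemma card_verts_bch_graph: "m > 0 \<Longrightarrow> card (verts (bch_graph m k)) = 3 * 2 ^ (m * k)"
  by (simp add: bch_graph_def card_cartesian_product card_vec)

text \<open>Each colour class is a matching: shifting by a fixed x is an involution, so a spoke of
  colour (x, t) is determined by either end, and the edges joining the two copies of a vertex are
  pairwise disjoint.\<close>

lemma bch_colour_proper:
  assumes k: "k > 0"
    and e: "e \<in> edges (bch_graph m k)" "e' \<in> edges (bch_graph m k)" "e \<inter> e' \<noteq> {}"
    and col: "bch_colour e = bch_colour e'"
  shows "e = e'"
proof -
  obtain u where u: "u \<in> e" "u \<in> e'" using e(3) by blast
  from e(1) show ?thesis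
  proof (cases rule: bch_edge_cases)
    case e: (1 v x t)
    then have t: "t > 0" by auto
    have c: "bch_colour e = (x, t)" unfolding e(1) by (rule bch_colour_spoke[OF k t])
    from \<open>e' \<in> _\<close> show ?thesis
    proof (cases rule: bch_edge_cases)
      case e': (1 v' x' t')
      then have t': "t' > 0" by auto
      have "bch_colour e' = (x', t')" unfolding e'(1) by (rule bch_colour_spoke[OF k t'])
      with c col have xt: "x' = x" "t' = t" by simp_all
      have "v = v' \<or> shift k v x = shift k v' x"
        using u t unfolding e(1) e'(1) xt by force
      then have "v = v'"
      proof
        assume "shift k v x = shift k v' x"
        then have "shift k (shift k v x) x = shift k (shift k v' x) x" by (rule arg_cong)
        then show "v = v'" by (simp only: shift_shift[OF e(2)] shift_shift[OF e'(2)])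
      qed
      then show ?thesis unfolding e(1) e'(1) xt by (rule arg_cong)
    next
      case e': (2 w)
      have "bch_colour e' = (0, 3)" unfolding e'(1) by (rule bch_colour_pair)
      with c col e(4) show ?thesis by simp
    qed
  next
    case e: (2 w)
    have c: "bch_colour e = (0, 3)" unfolding e(1) by (rule bch_colour_pair)
    from \<open>e' \<in> _\<close> show ?thesis
    proof (cases rule: bch_edge_cases)
      case e': (1 v x t)
      then have t: "t > 0" by auto
      have "bch_colour e' = (x, t)" unfolding e'(1) by (rule bch_colour_spoke[OF k t])
      with c col e'(4) show ?thesis by simp
    next
      case e': (2 w')
      have "w = w'" using u unfolding e(1) e'(1) by auto
      then show ?thesis unfolding e(1) e'(1) by simp
    qed
  qed
qed

lemma card_triangles_bch_graph:
  assumes "m > 0" "k > 0"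
  shows "card (triangles (edges (bch_graph m k))) \<ge> 2 ^ (m * k) * (2 ^ m - 1)"
proof -
  let ?P = "vec m k \<times> (GF m - {0})"
  let ?h = "\<lambda>(v, x). {(v, 0), (shift k v x, 1), (shift k v x, 2::nat)}"
  have "inj_on ?h ?P"
  proof (rule inj_onI)
    fix p p' assume "?h p = ?h p'"
    moreover obtain v x v' x' where p: "p = (v, x)" "p' = (v', x')" by fastforce
    ultimately have eq: "{(v, 0), (shift k v x, 1), (shift k v x, 2)} = {(v', 0), (shift k v' x', 1), (shift k v' x', 2::nat)}"
      by simp
    \<comment> \<open>The tags tell the vertices of the triangle apart: tag 0 gives v, tag 1 the
      shifted vector, and coordinate 0 of the latter then gives x.\<close>
    have "(v, 0) \<in> {(v', 0), (shift k v' x', 1), (shift k v' x', 2::nat)}"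
      "(shift k v x, 1) \<in> {(v', 0), (shift k v' x', 1), (shift k v' x', 2::nat)}"
      unfolding eq[symmetric] by simp_all
    then have v: "v = v'" and "shift k v x = shift k v' x'" by simp_all
    from this(2) have "shift k v x 0 = shift k v' x' 0" by simp
    then show "p = p'" using v assms(2) by (simp add: p shift_def)
  qed
  moreover have "?h ` ?P \<subseteq> triangles (edges (bch_graph m k))"
  proof (rule image_subsetI)
    fix p assume "p \<in> ?P"
    then obtain v x where p: "p = (v, x)" and vx: "v \<in> vec m k" "x \<in> GF m" "x \<noteq> 0" by auto
    then have "{(v, 0), (shift k v x, 1)} \<in> edges (bch_graph m k)"
      "{(v, 0), (shift k v x, 2)} \<in> edges (bch_graph m k)"
      using spoke_in_edges[OF vx] unfolding spoke_def by auto
    moreover have "{(shift k v x, 1), (shift k v x, 2)} \<in> edges (bch_graph m k)"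
      using shift_in_vec vx unfolding bch_graph_def by auto
    ultimately show "?h p \<in> triangles (edges (bch_graph m k))"
      unfolding p case_prod_conv by (intro trianglesI) simp_all
  qed
  ultimately have "card ?P \<le> card (triangles (edges (bch_graph m k)))"
    using finite_triangles[OF simple_bch_graph[OF assms(1)]] by (intro card_inj_on_le)
  moreover have "card ?P = 2 ^ (m * k) * (2 ^ m - 1)"
    using assms GF_closed(1)[of m] by (simp add: card_cartesian_product card_vec card_GF)
  ultimately show ?thesis by simp
qed

section \<open>Double counting along a rainbow cycle\<close>

lemma sum_cyclic_shift:
  fixes g :: "nat \<Rightarrow> 'b::comm_monoid_add"
  assumes "n > 0"
  shows "(\<Sum>i<n. g (Suc i mod n)) = (\<Sum>i<n. g i)"
proof -
  obtain l where n: "n = Suc l" using assms gr0_implies_Suc by blast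
  have "(\<Sum>i<Suc l. g (Suc i mod Suc l)) = (\<Sum>i<l. g (Suc i)) + g 0" by simp
  also have "\<dots> = (\<Sum>i<Suc l. g i)" by (simp only: sum.lessThan_Suc_shift add.commute)
  finally show ?thesis by (simp add: n)
qed

text \<open>The right-hand side is doubled because every vertex lies on two edges of the cycle.\<close>

lemma sum_over_cycle_edges:
  fixes g :: "'a \<Rightarrow> 'b::comm_monoid_add"
  assumes "inj_on f {..<n}" "n \<ge> 2"
  shows "(\<Sum>i<n. \<Sum>u\<in>{f i, f (Suc i mod n)}. g u) = (\<Sum>i<n. g (f i)) + (\<Sum>i<n. g (f i))"
proof -
  have "(\<Sum>u\<in>{f i, f (Suc i mod n)}. g u) = g (f i) + g (f (Suc i mod n))" if "i < n" for i
  proof -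
    have "Suc i mod n \<noteq> i" "Suc i mod n < n"
      using that assms(2) by (auto simp: mod_Suc)
    then have "f (Suc i mod n) \<noteq> f i" using inj_onD[OF assms(1)] that by auto
    then show ?thesis by simp
  qed
  then have "(\<Sum>i<n. \<Sum>u\<in>{f i, f (Suc i mod n)}. g u) = (\<Sum>i<n. g (f i)) + (\<Sum>i<n. g (f (Suc i mod n)))"
    by (simp add: sum.distrib)
  then show ?thesis using sum_cyclic_shift[of n "\<lambda>i. g (f i)"] assms(2) by simp
qed

text \<open>On a rainbow cycle the edges can be summed over through their colours. The doubled
  vertex sum on the right is used in two ways: it is 0 in characteristic two, and it is even among
  the naturals.\<close>

lemma sum_cycle_colours:
  fixes g :: "'a \<Rightarrow> 'b::comm_monoid_add" and h :: "'c \<Rightarrow> 'b"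
  assumes "inj_on f {..<n}" "n \<ge> 2" "inj_on (\<lambda>i. c {f i, f (Suc i mod n)}) {..<n}"
    and "\<And>i. i < n \<Longrightarrow> (\<Sum>u\<in>{f i, f (Suc i mod n)}. g u) = h (c {f i, f (Suc i mod n)})"
  shows "(\<Sum>x\<in>(\<lambda>i. c {f i, f (Suc i mod n)}) ` {..<n}. h x) = (\<Sum>i<n. g (f i)) + (\<Sum>i<n. g (f i))"
proof -
  have "(\<Sum>x\<in>(\<lambda>i. c {f i, f (Suc i mod n)}) ` {..<n}. h x) = (\<Sum>i<n. h (c {f i, f (Suc i mod n)}))"
    using assms(3) by (simp add: sum.reindex)
  also have "\<dots> = (\<Sum>i<n. \<Sum>u\<in>{f i, f (Suc i mod n)}. g u)"
    by (rule sum.cong) (simp_all only: assms(4) lessThan_iff)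
  finally show ?thesis using sum_over_cycle_edges[OF assms(1,2), of g] by simp
qed

lemma F2bar_sum_symdiff:
  fixes h :: "'a \<Rightarrow> F2bar"
  assumes "finite A" "finite B"
  shows "sum h (A - B) + sum h (B - A) = sum h A + sum h B"
proof -
  have "sum h A = sum h (A - B) + sum h (A \<inter> B)" "sum h B = sum h (B - A) + sum h (A \<inter> B)"
    using sum.Int_Diff[OF assms(1), of h B] sum.Int_Diff[OF assms(2), of h A]
    by (simp_all add: Int_commute add.commute)
  then show ?thesis by (simp add: add_ac)
qed

text \<open>The witness \<open>a\<close> is the common number of spokes with tag 1 and with tag 2,
  and \<open>b\<close> is the number of edges of colour (0, 3). The conclusion says that n is 0 or 3
  modulo 4.\<close>

lemma rainbow_cycle_bch_graph:
  assumes m: "m > 0" and k: "k > 0" and n: "n \<le> 2 * k + 1" "n \<ge> 2"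
    and f: "cycle_in (edges (bch_graph m k)) n f"
    and rb: "inj_on (\<lambda>i. bch_colour {f i, f (Suc i mod n)}) {..<n}"
  shows "\<exists>a b. n = 2 * a + b \<and> b \<le> 1 \<and> even (a + b)"
proof -
  define C where "C = (\<lambda>i. bch_colour {f i, f (Suc i mod n)}) ` {..<n}"
  define A where "A t = {x. (x, t) \<in> C}" for t :: nat
  have edge: "{f i, f (Suc i mod n)} \<in> edges (bch_graph m k)" if "i < n" for i
    using f that by (simp add: cycle_in_def)
  have inj: "inj_on f {..<n}" using f by (simp add: cycle_in_def)
  have cols: "(snd c = 1 \<or> snd c = 2) \<and> fst c \<noteq> 0 \<or> c = (0, 3)" if "c \<in> C" for c
    using bch_edge_sums(4)[OF k edge] that unfolding C_def by force
  have finC: "finite C" by (simp add: C_def)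
  have cardC: "card C = n" unfolding C_def using rb by (simp add: card_image)
  have C_eq: "C = (A 1 \<times> {1}) \<union> (A 2 \<times> {2}) \<union> (A 3 \<times> {3})"
  proof
    show "C \<subseteq> (A 1 \<times> {1}) \<union> (A 2 \<times> {2}) \<union> (A 3 \<times> {3})"
    proof
      fix c assume "c \<in> C"
      then show "c \<in> (A 1 \<times> {1}) \<union> (A 2 \<times> {2}) \<union> (A 3 \<times> {3})"
        using cols[of c] by (cases c) (auto simp: A_def)
    qed
  qed (auto simp: A_def)
  have "0 \<notin> A 1" using cols[of "(0, 1)"] by (auto simp: A_def)
  moreover have "0 \<notin> A 2" using cols[of "(0, 2)"] by (auto simp: A_def)
  moreover have "A 3 \<subseteq> {0}" using cols[of "(_, 3)"] by (auto simp: A_def)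
  ultimately have C_sub: "A 3 \<subseteq> {0}" "0 \<notin> A 1" "0 \<notin> A 2" by auto
  have finA: "finite (A t)" for t
  proof -
    have "A t = fst ` (C \<inter> UNIV \<times> {t})" by (force simp: A_def)
    then show ?thesis using finC by simp
  qed
  have sum_C: "(\<Sum>c\<in>C. h c) = (\<Sum>x\<in>A 1. h (x, 1)) + (\<Sum>x\<in>A 2. h (x, 2)) + (\<Sum>x\<in>A 3. h (x, 3))"
    for h :: "F2bar \<times> nat \<Rightarrow> 'z::comm_monoid_add"
  proof -
    have t: "(\<Sum>c\<in>A t \<times> {t}. h c) = (\<Sum>x\<in>A t. h (x, t))" for t
    proof -
      have "A t \<times> {t} = (\<lambda>x. (x, t)) ` A t" by auto
      then show ?thesis by (simp add: sum.reindex inj_on_def)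
    qed
    show ?thesis
      unfolding C_eq by (subst sum.union_disjoint; (subst sum.union_disjoint)?) (auto simp: finA t)
  qed
  note sum_cycle = sum_cycle_colours[OF inj n(2) rb, folded C_def]
  have powers: "(\<Sum>x\<in>A 1. x ^ (2 * j + 1)) + (\<Sum>x\<in>A 2. x ^ (2 * j + 1)) = 0" if j: "j < k" for j
  proof -
    have "(\<Sum>c\<in>C. fst c ^ (2 * j + 1)) = 0"
    proof (subst sum_cycle[where g = "\<lambda>u. fst u j"])
      show "(\<Sum>u\<in>{f i, f (Suc i mod n)}. fst u j) = fst (bch_colour {f i, f (Suc i mod n)}) ^ (2 * j + 1)"
        if "i < n" for i
        by (rule bch_edge_sums(1)[OF k edge[OF that] j])
    qed simp
    moreover have "(\<Sum>x\<in>A 3. x ^ (2 * j + 1)) = 0"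
      using C_sub(1) by (intro sum.neutral) auto
    ultimately show ?thesis by (simp add: sum_C)
  qed
  \<comment> \<open>Count ends with tag 0: every spoke has one, and the edge between two copies has
    none.\<close>
  have even_spokes: "even (card (A 1) + card (A 2))"
  proof -
    have "(\<Sum>c\<in>C. if snd c = 3 then 0 else (1::nat)) = (\<Sum>i<n. of_bool (snd (f i) = 0)) + (\<Sum>i<n. of_bool (snd (f i) = 0))"
    by (rule sum_cycle, rule bch_edge_sums(2)[OF k edge])
    then show ?thesis by (simp add: sum_C)
  qed
  \<comment> \<open>Count ends with tag 1: the spokes with tag 1 and the edge between two copies
    have one each.\<close>
  have even_first: "even (card (A 1) + card (A 3))"
  proof -
    have "(\<Sum>c\<in>C. if snd c = 2 then 0 else (1::nat)) = (\<Sum>i<n. of_bool (snd (f i) = 1)) + (\<Sum>i<n. of_bool (snd (f i) = 1))"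
    by (rule sum_cycle, rule bch_edge_sums(3)[OF k edge])
    then show ?thesis by (simp add: sum_C)
  qed
  have n_eq: "n = card (A 1) + card (A 2) + card (A 3)"
    using sum_C[of "\<lambda>_. 1::nat"] cardC by simp
  have A3: "card (A 3) \<le> 1"
    using card_mono[OF _ C_sub(1)] by simp
  \<comment> \<open>Even for n = 2k + 1 there are at most 2k spokes, because their number is
    even.\<close>
  have A12: "card (A 1) + card (A 2) \<le> 2 * k"
    using even_spokes n_eq n(1) by presburger
  have "A 1 = A 2"
  proof (rule ccontr)
    assume "A 1 \<noteq> A 2"
    \<comment> \<open>Colours x occurring with both tags cancel, so \<open>B\<close> inherits the
      vanishing odd power sums. It consists of at most 2k nonzero elements, and the BCH bound makes
      it empty.\<close>
    define B where "B = (A 1 - A 2) \<union> (A 2 - A 1)"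
    have B: "finite B" "B \<noteq> {}" "0 \<notin> B" using \<open>A 1 \<noteq> A 2\<close> C_sub finA by (auto simp: B_def)
    have "card B \<le> card (A 1 - A 2) + card (A 2 - A 1)" unfolding B_def by (rule card_Un_le)
    also have "\<dots> \<le> card (A 1) + card (A 2)" using finA by (intro add_mono card_mono) auto
    finally have "card B \<le> 2 * k" using A12 by simp
    from odd_power_sums_nonzero[OF B this] obtain j where j: "j < k" "(\<Sum>x\<in>B. x ^ (2 * j + 1)) \<noteq> 0" by blast
    have "(\<Sum>x\<in>B. x ^ (2 * j + 1)) = (\<Sum>x\<in>A 1 - A 2. x ^ (2 * j + 1)) + (\<Sum>x\<in>A 2 - A 1. x ^ (2 * j + 1))"
      unfolding B_def by (intro sum.union_disjoint) (auto simp: finA)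
    also have "\<dots> = (\<Sum>x\<in>A 1. x ^ (2 * j + 1)) + (\<Sum>x\<in>A 2. x ^ (2 * j + 1))"
      by (rule F2bar_sum_symdiff[OF finA finA])
    also have "\<dots> = 0" by (rule powers[OF j(1)])
    finally show False using j(2) by simp
  qed
  then show ?thesis
    using n_eq A3 even_first by (intro exI[of _ "card (A 1)"] exI[of _ "card (A 3)"]) simp
qed

lemma ex_copies_rainbow_ge_bch:
  assumes "m > 0" "k \<ge> 2" "n \<ge> 3 * 2 ^ (m * k)"
    and l: "odd k \<and> l = 2 * k \<or> even k \<and> l = 2 * k + 1"
  shows "ex_copies_rainbow n (cycle_graph 3) (cycle_graph l) \<ge> 2 ^ (m * k) * (2 ^ m - 1)"
proof -
  have "card (triangles (edges (bch_graph m k))) \<le> ex_copies_rainbow n (cycle_graph 3) (cycle_graph l)"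
  proof (rule ex_copies_rainbow_ge[where c = bch_colour])
    show "simple_graph (bch_graph m k)" using assms by (simp add: simple_bch_graph)
    show "card (verts (bch_graph m k)) \<le> n" using assms by (simp add: card_verts_bch_graph)
    show "l \<ge> 3" using assms by auto
    show "bch_colour e \<noteq> bch_colour e'" if "e \<in> edges (bch_graph m k)" "e' \<in> edges (bch_graph m k)"
      "e \<noteq> e'" "e \<inter> e' \<noteq> {}" for e e'
      using bch_colour_proper[OF _ that(1,2,4)] that(3) assms by auto
    show "\<not> inj_on (\<lambda>i. bch_colour {f i, f (Suc i mod l)}) {..<l}"
      if "cycle_in (edges (bch_graph m k)) l f" for f
    proof
      assume "inj_on (\<lambda>i. bch_colour {f i, f (Suc i mod l)}) {..<l}"
      with rainbow_cycle_bch_graph[OF assms(1) _ _ _ that] obtain a b where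
        "l = 2 * a + b" "b \<le> 1" "even (a + b)" using assms by auto
      with l show False by presburger
    qed
  qed
  with card_triangles_bch_graph[of m k] assms show ?thesis by linarith
qed

section \<open>Doubling one side of a bipartite graph\<close>

lemma successively_cyclic_iff:
  assumes "xs \<noteq> []"
  shows "successively R (xs @ [hd xs]) \<longleftrightarrow> (\<forall>i<length xs. R (xs ! i) (xs ! (Suc i mod length xs)))"
proof -
  have "(xs @ [hd xs]) ! Suc i = xs ! (Suc i mod length xs)" if "i < length xs" for i
    using that assms by (cases "Suc i = length xs") (auto simp: nth_append hd_conv_nth)
  then show ?thesis
    by (auto simp: successively_conv_nth nth_append)
qed

text \<open>The shadow of an edge of the doubled graph: it stands still outside \<open>U\<close> on
  an edge between two copies, and otherwise crosses between \<open>U\<close> and its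
  complement.\<close>

definition lazy_step :: "'a set \<Rightarrow> 'a set set \<Rightarrow> 'a \<Rightarrow> 'a \<Rightarrow> bool" where
  "lazy_step U E p q \<longleftrightarrow> (p = q \<and> p \<notin> U) \<or> ({p, q} \<in> E \<and> (p \<in> U \<longleftrightarrow> q \<notin> U))"

text \<open>A closed walk splits at a repeated vertex into two closed walks sharing that vertex.\<close>

lemma closed_lazy_walk:
  assumes no_cycle: "\<And>j f. 2 \<le> j \<Longrightarrow> j \<le> k \<Longrightarrow> \<not> cycle_in E (2 * j) f"
    and "xs \<noteq> []" "successively (lazy_step U E) (xs @ [hd xs])"
    and "distinct (filter (\<lambda>p. p \<in> U) xs)" "length (filter (\<lambda>p. p \<in> U) xs) \<le> k"
    and "p \<in> set xs - U" "q \<in> set xs - U"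
  shows "p = q"
  using assms(2-)
proof (induction "length xs" arbitrary: xs p q rule: less_induct)
  case less
  show ?case
  proof (cases "distinct xs")
    case True
    define m where "m = length xs"
    have step: "lazy_step U E (xs ! i) (xs ! (Suc i mod m))" if "i < m" for i
      using less.prems(2) that unfolding successively_cyclic_iff[OF less.prems(1)] m_def by blast
    show ?thesis
    proof (cases "m \<ge> 3")
      case True
      have inj: "inj_on ((!) xs) {..<m}"
        using \<open>distinct xs\<close> by (simp add: inj_on_nth m_def)
      have edge: "{xs ! i, xs ! (Suc i mod m)} \<in> E \<and> (xs ! i \<in> U \<longleftrightarrow> xs ! (Suc i mod m) \<notin> U)"
        if i: "i < m" for i
      proof -
        have "Suc i mod m \<noteq> i" "Suc i mod m < m" using i True by (auto simp: mod_Suc)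
        then have "xs ! (Suc i mod m) \<noteq> xs ! i"
          using inj_onD[OF inj] i by auto
        then show ?thesis using step[OF i] by (auto simp: lazy_step_def)
      qed
      then have cyc: "cycle_in E m ((!) xs)" using inj by (simp add: cycle_in_def)
      \<comment> \<open>Each edge of the cycle has exactly one end in \<open>U\<close>, so its
        length is twice the number r \<le> k of its vertices in \<open>U\<close>; such a cycle is
        forbidden.\<close>
      define r where "r = (\<Sum>i<m. of_bool (xs ! i \<in> U) :: nat)"
      have one: "(\<Sum>u\<in>{xs ! i, xs ! (Suc i mod m)}. of_bool (u \<in> U)) = (1::nat)" if "i < m" for i
      proof -
        have "xs ! i \<noteq> xs ! (Suc i mod m)" using edge[OF that] by auto
        then have "(\<Sum>u\<in>{xs ! i, xs ! (Suc i mod m)}. of_bool (u \<in> U)) =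
            of_bool (xs ! i \<in> U) + (of_bool (xs ! (Suc i mod m) \<in> U) :: nat)" by simp
        then show ?thesis using edge[OF that] by (cases "xs ! i \<in> U") simp_all
      qed
      have "m = (\<Sum>i<m. 1)" by simp
      also have "\<dots> = (\<Sum>i<m. \<Sum>u\<in>{xs ! i, xs ! (Suc i mod m)}. of_bool (u \<in> U))"
        by (rule sum.cong) (simp_all only: one lessThan_iff)
      also have "\<dots> = r + r"
        unfolding r_def using True by (intro sum_over_cycle_edges[OF inj]) simp
      finally have m: "m = 2 * r" by simp
      have "{..<m} \<inter> {i. xs ! i \<in> U} = {i. i < length xs \<and> xs ! i \<in> U}"
        by (auto simp: m_def)
      then have "r = length (filter (\<lambda>p. p \<in> U) xs)"
        by (simp add: r_def length_filter_conv_card)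
      then have "r \<le> k" using less.prems(4) by simp
      then show ?thesis using no_cycle[of r "(!) xs"] cyc m True by simp
    next
      case False
      have "p = q" if "i < m" "j < m" "p = xs ! i" "q = xs ! j" for i j
      proof -
        have "m > 0" using less.prems(1) by (simp add: m_def)
        then have "m = 1 \<or> m = 2" using False by linarith
        then show ?thesis
        proof
          assume "m = 2"
          then have "lazy_step U E (xs ! 0) (xs ! 1)" using step[of 0] by simp
          moreover have "i = 0 \<or> i = 1" "j = 0 \<or> j = 1" using \<open>m = 2\<close> that(1,2) by auto
          ultimately show ?thesis using that(3,4) less.prems(5,6) by (auto simp: lazy_step_def)
        qed (use that in simp)
      qed
      then show ?thesis using less.prems(5,6) by (auto simp: in_set_conv_nth m_def)
    qed
  next
    case False
    then obtain as y bs cs where xs: "xs = as @ [y] @ bs @ [y] @ cs"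
      using not_distinct_decomp by blast
    \<comment> \<open>Vertices of \<open>U\<close> occur only once, so the repeated vertex lies
      outside \<open>U\<close>. Each of the two shorter walks then collapses to y outside
      \<open>U\<close>.\<close>
    have y: "y \<notin> U" using less.prems(3) by (auto simp: xs)
    have walk: "successively (lazy_step U E) (as @ [y] @ bs @ [y] @ cs @ [hd (as @ [y])])"
      using less.prems(2) by (cases as) (simp_all add: xs)
    define us where "us = y # bs"
    define ws where "ws = as @ y # cs"
    have "successively (lazy_step U E) (us @ [hd us])"
      using walk by (cases bs) (simp_all add: us_def successively_append_iff successively_Cons hd_append split: if_splits)
    moreover have "length us < length xs" "us \<noteq> []" by (simp_all add: us_def xs)
    moreover have "distinct (filter (\<lambda>p. p \<in> U) us)" "length (filter (\<lambda>p. p \<in> U) us) \<le> k"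
      using less.prems(3,4) y by (auto simp: us_def xs)
    ultimately have us: "a = b" if "a \<in> set us - U" "b \<in> set us - U" for a b
      using less.hyps[of us] that by blast
    have "successively (lazy_step U E) (ws @ [hd ws])"
      using walk by (cases as) (simp_all add: ws_def successively_append_iff successively_Cons hd_append split: if_splits)
    moreover have "length ws < length xs" "ws \<noteq> []" by (simp_all add: ws_def xs)
    moreover have "distinct (filter (\<lambda>p. p \<in> U) ws)" "length (filter (\<lambda>p. p \<in> U) ws) \<le> k"
      using less.prems(3,4) y by (auto simp: ws_def xs)
    ultimately have ws: "a = b" if "a \<in> set ws - U" "b \<in> set ws - U" for a b
      using less.hyps[of ws] that by blast
    have "set xs = set us \<union> set ws" by (auto simp: xs us_def ws_def)
    moreover have "y \<in> set us - U" "y \<in> set ws - U" using y by (simp_all add: us_def ws_def)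
    ultimately have "a = y" if "a \<in> set xs - U" for a
      using us[of a y] ws[of a y] that by blast
    then show ?thesis using less.prems(5,6) by blast
  qed
qed


definition double_graph :: "'a set \<Rightarrow> 'a set \<Rightarrow> 'a set set \<Rightarrow> ('a \<times> bool) ugraph" where
  "double_graph U W E = (U \<times> {False} \<union> W \<times> UNIV,
     {{(x, False), (y, b)} | x y b. x \<in> U \<and> y \<in> W \<and> {x, y} \<in> E} \<union>
     {{(y, False), (y, True)} | y. y \<in> W})"

lemma double_edge_cases:
  assumes "e \<in> edges (double_graph U W E)"
  obtains x y b where "e = {(x, False), (y, b)}" "x \<in> U" "y \<in> W" "{x, y} \<in> E"
    | y where "e = {(y, False), (y, True)}" "y \<in> W"
  using assms unfolding double_graph_def snd_conv by blast

context
  fixes U W :: "'a set" and E :: "'a set set"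
  assumes disj: "U \<inter> W = {}" and fin: "finite U" "finite W"
begin

lemma simple_double_graph: "simple_graph (double_graph U W E)"
  unfolding simple_graph_def
proof (intro conjI ballI)
  show "finite (verts (double_graph U W E))" using fin by (simp add: double_graph_def)
  fix e assume "e \<in> edges (double_graph U W E)"
  then have "e \<subseteq> verts (double_graph U W E) \<and> card e = 2"
  proof (cases rule: double_edge_cases)
    case (1 x y b)
    then have "x \<noteq> y" using disj by auto
    with 1 show ?thesis by (simp add: double_graph_def)
  qed (simp add: double_graph_def)
  then show "e \<subseteq> verts (double_graph U W E)" "card e = 2" by simp_all
qed

text \<open>An edge xy across the cut becomes the triangle of x and the two copies of y, from which
  the edge can be recovered.\<close>

lemma card_triangles_double_graph:
  "card {e \<in> E. \<exists>x\<in>U. \<exists>y\<in>W. e = {x, y}} \<le> card (triangles (edges (double_graph U W E)))"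
proof -
  define P where "P = {(x, y). x \<in> U \<and> y \<in> W \<and> {x, y} \<in> E}"
  have finP: "finite P"
    by (rule finite_subset[of _ "U \<times> W"]) (use fin in \<open>auto simp: P_def\<close>)
  have "{e \<in> E. \<exists>x\<in>U. \<exists>y\<in>W. e = {x, y}} \<subseteq> (\<lambda>(x, y). {x, y}) ` P"
    by (auto simp: P_def image_iff)
  then have "card {e \<in> E. \<exists>x\<in>U. \<exists>y\<in>W. e = {x, y}} \<le> card P"
    by (rule surj_card_le[OF finP])
  also have "\<dots> \<le> card (triangles (edges (double_graph U W E)))"
  proof (rule card_inj_on_le[of "\<lambda>(x, y). {(x, False), (y, False), (y, True)}"])
    show "inj_on (\<lambda>(x, y). {(x, False), (y, False), (y, True)}) P"
    proof (rule inj_onI)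
      fix p q assume pq: "p \<in> P" "q \<in> P"
        and eq: "(\<lambda>(x, y). {(x, False), (y, False), (y, True)}) p = (\<lambda>(x, y). {(x, False), (y, False), (y, True)}) q"
      obtain x y x' y' where p: "p = (x, y)" "q = (x', y')" by fastforce
      have eq: "{(x, False), (y, False), (y, True)} = {(x', False), (y', False), (y', True)}"
        using eq by (simp add: p)
      have "(y, True) \<in> {(x', False), (y', False), (y', True)}" "(x, False) \<in> {(x', False), (y', False), (y', True)}"
        unfolding eq[symmetric] by simp_all
      moreover have "x \<noteq> y'" using pq disj by (auto simp: p P_def)
      ultimately show "p = q" by (simp add: p)
    qed
    show "(\<lambda>(x, y). {(x, False), (y, False), (y, True)}) ` P \<subseteq> triangles (edges (double_graph U W E))"
    proof (rule image_subsetI)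
      fix p assume "p \<in> P"
      then obtain x y where p: "p = (x, y)" "x \<in> U" "y \<in> W" "{x, y} \<in> E" by (auto simp: P_def)
      then have "{(x, False), (y, b)} \<in> edges (double_graph U W E)" for b
        unfolding double_graph_def snd_conv by blast
      moreover have "{(y, False), (y, True)} \<in> edges (double_graph U W E)"
        using p(3) unfolding double_graph_def snd_conv by blast
      moreover have "x \<noteq> y" using p disj by auto
      ultimately show "(\<lambda>(x, y). {(x, False), (y, False), (y, True)}) p \<in> triangles (edges (double_graph U W E))"
        unfolding p(1) case_prod_conv by (intro trianglesI) simp_all
    qed
    show "finite (triangles (edges (double_graph U W E)))"
      by (rule finite_triangles[OF simple_double_graph])
  qed
  finally show ?thesis .
qed

text \<open>Such a cycle projects to a closed walk meeting only one vertex of \<open>W\<close>, so it has at most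
  two vertices over \<open>W\<close> and hence at most four in total.\<close>

lemma no_cycle_in_double_graph:
  assumes no_cycle: "\<And>j f. 2 \<le> j \<Longrightarrow> j \<le> k \<Longrightarrow> \<not> cycle_in E (2 * j) f"
    and m: "5 \<le> m" "m \<le> 2 * k + 1"
  shows "\<not> cycle_in (edges (double_graph U W E)) m f"
proof
  assume f: "cycle_in (edges (double_graph U W E)) m f"
  then have inj: "inj_on f {..<m}"
    and edge: "\<And>i. i < m \<Longrightarrow> {f i, f (Suc i mod m)} \<in> edges (double_graph U W E)"
    by (auto simp: cycle_in_def)
  define p where "p i = fst (f i)" for i
  define xs where "xs = map p [0..<m]"
  have len: "length xs = m" and nth: "\<And>i. i < m \<Longrightarrow> xs ! i = p i" by (simp_all add: xs_def)
  \<comment> \<open>A vertex of \<open>U\<close> has a single copy, so the projection is injective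
    on the part of the cycle over \<open>U\<close>.\<close>
  have tag: "f i = (p i, False)" if "i < m" "p i \<in> U" for i
    using edge[OF that(1)]
  proof (cases rule: double_edge_cases)
    case (1 x y b)
    then have "f i = (x, False) \<or> f i = (y, b)" unfolding doubleton_eq_iff by argo
    moreover have "fst (f i) \<noteq> y" using that(2) 1(3) disj by (auto simp: p_def)
    ultimately show ?thesis by (auto simp: p_def)
  next
    case (2 y)
    then have "fst (f i) = y" unfolding doubleton_eq_iff by (metis fst_conv)
    then show ?thesis using that(2) 2(2) disj by (auto simp: p_def)
  qed
  have edge_ends: "(p i = p (Suc i mod m) \<and> p i \<in> W) \<or>
     ({p i, p (Suc i mod m)} \<in> E \<and> (p i \<in> U \<and> p (Suc i mod m) \<in> W \<or> p i \<in> W \<and> p (Suc i mod m) \<in> U))"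
    if "i < m" for i
    using edge[OF that]
  proof (cases rule: double_edge_cases)
    case (1 x y b)
    then have "p i = x \<and> p (Suc i mod m) = y \<or> p i = y \<and> p (Suc i mod m) = x"
      unfolding p_def doubleton_eq_iff by (metis fst_conv)
    moreover have "{y, x} = {x, y}" by auto
    ultimately show ?thesis using 1(2-4) by (elim disjE conjE) simp_all
  next
    case (2 y)
    then have "p i = y \<and> p (Suc i mod m) = y"
      unfolding p_def doubleton_eq_iff by (metis fst_conv)
    then show ?thesis using 2 by simp
  qed
  have step: "lazy_step U E (p i) (p (Suc i mod m))" if "i < m" for i
    using edge_ends[OF that] disj by (auto simp: lazy_step_def)
  define r where "r = (\<Sum>i<m. of_bool (p i \<in> U) :: nat)"
  define w where "w = (\<Sum>i<m. of_bool (p i \<in> W) :: nat)"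
  have ends: "(\<Sum>u\<in>{f i, f (Suc i mod m)}. of_bool (fst u \<in> Z)) =
      of_bool (p i \<in> Z) + (of_bool (p (Suc i mod m) \<in> Z) :: nat)" if "i < m" for i Z
  proof -
    have "Suc i mod m \<noteq> i" "Suc i mod m < m" using that m by (auto simp: mod_Suc)
    then have "f i \<noteq> f (Suc i mod m)" using inj_onD[OF inj, of i "Suc i mod m"] that by auto
    then show ?thesis by (simp add: p_def)
  qed
  \<comment> \<open>No edge has both ends over \<open>U\<close>, so at most half of the m \<le> 2k +
    1 vertices lie there, that is, at most k.\<close>
  have "r + r = (\<Sum>i<m. \<Sum>u\<in>{f i, f (Suc i mod m)}. of_bool (fst u \<in> U))"
    unfolding r_def p_def using m by (intro sum_over_cycle_edges[OF inj, symmetric]) simp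
  also have "\<dots> \<le> (\<Sum>i<m. 1)"
  proof (rule sum_mono)
    fix i assume "i \<in> {..<m}"
    then have i: "i < m" by simp
    have "\<not> (p i \<in> U \<and> p (Suc i mod m) \<in> U)" using edge_ends[OF i] disj by blast
    then show "(\<Sum>u\<in>{f i, f (Suc i mod m)}. of_bool (fst u \<in> U)) \<le> (1::nat)"
      unfolding ends[OF i] by (cases "p i \<in> U") simp_all
  qed
  finally have "r + r \<le> m" by simp
  then have r: "r \<le> k" using m by linarith
  have filter: "filter (\<lambda>p. p \<in> U) xs = map p (filter (\<lambda>i. p i \<in> U) [0..<m])"
    by (simp add: xs_def filter_map comp_def)
  have distinct: "distinct (filter (\<lambda>p. p \<in> U) xs)"
    unfolding filter distinct_map
  proof (intro conjI inj_onI)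
    fix i j assume "i \<in> set (filter (\<lambda>i. p i \<in> U) [0..<m])" "j \<in> set (filter (\<lambda>i. p i \<in> U) [0..<m])" "p i = p j"
    then have ij: "i < m" "j < m" "p i \<in> U" "p j \<in> U" "p i = p j" by auto
    then have "f i = f j"
      using tag[of i] tag[of j] by simp
    then show "i = j" using inj_onD[OF inj] ij by auto
  qed simp
  have "{..<m} \<inter> {i. p i \<in> U} = {i. i < length xs \<and> xs ! i \<in> U}"
    using nth by (auto simp: len)
  then have "length (filter (\<lambda>p. p \<in> U) xs) = r"
    by (simp add: r_def length_filter_conv_card)
  then have len_le: "length (filter (\<lambda>p. p \<in> U) xs) \<le> k" using r by simp
  have nonempty: "xs \<noteq> []" using m(1) len by (cases xs) simp_all
  have walk: "successively (lazy_step U E) (xs @ [hd xs])"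
    unfolding successively_cyclic_iff[OF nonempty] len
  proof (intro allI impI)
    fix i assume i: "i < m"
    then have "Suc i mod m < m" by simp
    with i step show "lazy_step U E (xs ! i) (xs ! (Suc i mod m))" by (simp only: nth)
  qed
  note same = closed_lazy_walk[OF no_cycle nonempty walk distinct len_le]
  have "card {i. i < m \<and> p i \<in> W} \<le> 2"
  proof (cases "\<exists>i<m. p i \<in> W")
    case True
    then obtain i0 where i0: "i0 < m" "p i0 \<in> W" by blast
    have "f ` {i. i < m \<and> p i \<in> W} \<subseteq> {p i0} \<times> UNIV"
    proof (rule image_subsetI)
      fix i assume "i \<in> {i. i < m \<and> p i \<in> W}"
      then have "p i \<in> set xs - U" "p i0 \<in> set xs - U" using i0 disj by (auto simp: xs_def)
      then have "p i = p i0" using same by blast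
      then show "f i \<in> {p i0} \<times> UNIV" by (auto simp: p_def mem_Times_iff)
    qed
    then have "card {i. i < m \<and> p i \<in> W} \<le> card ({p i0} \<times> (UNIV :: bool set))"
      using inj by (intro card_inj_on_le[of f]) (auto intro: inj_on_subset)
    then show ?thesis by (simp add: card_cartesian_product)
  next
    case False
    then have "{i. i < m \<and> p i \<in> W} = {}" by blast
    then show ?thesis by (simp only: card.empty le0)
  qed
  moreover have "w = card {i. i < m \<and> p i \<in> W}"
    by (simp add: w_def Int_def)
  ultimately have w: "w \<le> 2" by simp
  \<comment> \<open>Every edge has an end over \<open>W\<close> and every vertex lies on two edges,
    so m \<le> 2w \<le> 4.\<close>
  have "m = (\<Sum>i<m. 1)" by simp
  also have "\<dots> \<le> (\<Sum>i<m. \<Sum>u\<in>{f i, f (Suc i mod m)}. of_bool (fst u \<in> W))"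
  proof (rule sum_mono)
    fix i assume "i \<in> {..<m}"
    then have i: "i < m" by simp
    have "p i \<in> W \<or> p (Suc i mod m) \<in> W" using edge_ends[OF i] by metis
    then show "1 \<le> (\<Sum>u\<in>{f i, f (Suc i mod m)}. of_bool (fst u \<in> W) :: nat)"
      unfolding ends[OF i] by auto
  qed
  also have "\<dots> = w + w"
    unfolding w_def p_def using m by (intro sum_over_cycle_edges[OF inj]) simp
  finally show False using w m by simp
qed

end

section \<open>A bipartite subgraph on half of the vertices\<close>

text \<open>Greedy choice: each new vertex joins the side that contains at most half of its earlier
  neighbours, so at least half of its new edges are cut.\<close>

lemma max_cut:
  assumes "finite V" "finite E" "\<And>e. e \<in> E \<Longrightarrow> e \<subseteq> V \<and> card e = 2"
  shows "\<exists>U\<subseteq>V. card E \<le> 2 * card {e \<in> E. \<exists>x\<in>U. \<exists>y\<in>V - U. e = {x, y}}"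
  using assms
proof (induction V arbitrary: E rule: finite_induct)
  case empty
  then have "E = {}" by fastforce
  then show ?case by simp
next
  case (insert v V)
  define E' where "E' = {e \<in> E. v \<notin> e}"
  define N where "N = nbrs E v"
  have "\<exists>U\<subseteq>V. card E' \<le> 2 * card {e \<in> E'. \<exists>x\<in>U. \<exists>y\<in>V - U. e = {x, y}}"
    using insert.prems by (intro insert.IH) (auto simp: E'_def)
  then obtain U where U: "U \<subseteq> V" and IH: "card E' \<le> 2 * card {e \<in> E'. \<exists>x\<in>U. \<exists>y\<in>V - U. e = {x, y}}" by blast
  have finN: "finite N"
  proof (rule finite_subset)
    show "N \<subseteq> insert v V" using insert.prems(2) by (force simp: N_def nbrs_def)
  qed (use insert.hyps in simp)
  have vN: "v \<notin> N" using insert.prems(2)[of "{v}"] by (auto simp: N_def nbrs_def)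
  have NV: "N \<subseteq> V" using insert.prems(2) vN by (force simp: N_def nbrs_def)
  have star: "(\<lambda>w. {v, w}) ` M \<subseteq> E" if "M \<subseteq> N" for M using that by (auto simp: N_def nbrs_def)
  have inj: "inj_on (\<lambda>w. {v, w}) M" for M by (auto simp: inj_on_def doubleton_eq_iff)
  have "E \<subseteq> E' \<union> (\<lambda>w. {v, w}) ` N"
  proof
    fix e assume e: "e \<in> E"
    show "e \<in> E' \<union> (\<lambda>w. {v, w}) ` N"
    proof (cases "v \<in> e")
      case True
      obtain a b where "e = {a, b}" using insert.prems(2)[OF e] by (auto simp: card_2_iff)
      with True obtain w where "e = {v, w}" by auto
      with e show ?thesis by (auto simp: N_def nbrs_def)
    qed (use e in \<open>simp add: E'_def\<close>)
  qed
  then have "card E \<le> card (E' \<union> (\<lambda>w. {v, w}) ` N)"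
    using insert.prems(1) finN by (intro card_mono) (auto simp: E'_def)
  also have "\<dots> \<le> card E' + card ((\<lambda>w. {v, w}) ` N)" by (rule card_Un_le)
  also have "card ((\<lambda>w. {v, w}) ` N) = card N" using inj by (rule card_image)
  also have "card N = card (N \<inter> U) + card (N - U)" using finN by (metis card_Int_Diff)
  finally have E: "card E \<le> card E' + card (N \<inter> U) + card (N - U)" by simp
  let ?C = "\<lambda>U'. {e \<in> E. \<exists>x\<in>U'. \<exists>y\<in>insert v V - U'. e = {x, y}}"
  let ?C' = "{e \<in> E'. \<exists>x\<in>U. \<exists>y\<in>V - U. e = {x, y}}"
  have cut: "card ?C' + card M \<le> card (?C U')"
    if M: "M \<subseteq> N" and sub: "?C' \<subseteq> ?C U'" "(\<lambda>w. {v, w}) ` M \<subseteq> ?C U'" for M U'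
  proof -
    have "?C' \<inter> (\<lambda>w. {v, w}) ` M = {}" by (auto simp: E'_def)
    then have "card (?C' \<union> (\<lambda>w. {v, w}) ` M) = card ?C' + card M"
      using inj[of M] finN M insert.prems(1)
      by (subst card_Un_disjoint) (auto simp: E'_def card_image intro: finite_subset)
    moreover have "card (?C' \<union> (\<lambda>w. {v, w}) ` M) \<le> card (?C U')"
      using sub insert.prems(1) by (intro card_mono) auto
    ultimately show ?thesis by simp
  qed
  show ?case
  proof (cases "card (N - U) \<le> card (N \<inter> U)")
    case True
    have "card ?C' + card (N \<inter> U) \<le> card (?C U)"
    proof (rule cut)
      show "?C' \<subseteq> ?C U" by (auto simp: E'_def)
      show "(\<lambda>w. {v, w}) ` (N \<inter> U) \<subseteq> ?C U"
      proof (rule image_subsetI)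
        fix w assume w: "w \<in> N \<inter> U"
        then have "{v, w} \<in> E" by (auto simp: N_def nbrs_def)
        moreover have "v \<in> insert v V - U" using insert.hyps(2) U by auto
        moreover have "{v, w} = {w, v}" by auto
        ultimately show "{v, w} \<in> ?C U" using w by blast
      qed
    qed simp
    then have "card E \<le> 2 * card (?C U)" using E IH True by linarith
    with U show ?thesis by blast
  next
    case False
    have "card ?C' + card (N - U) \<le> card (?C (insert v U))"
    proof (rule cut)
      show "?C' \<subseteq> ?C (insert v U)"
      proof
        fix e assume "e \<in> ?C'"
        then obtain x y where "e \<in> E" "v \<notin> e" "x \<in> U" "y \<in> V - U" "e = {x, y}" by (auto simp: E'_def)
        then show "e \<in> ?C (insert v U)" by blast
      qed
      show "(\<lambda>w. {v, w}) ` (N - U) \<subseteq> ?C (insert v U)"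
      proof (rule image_subsetI)
        fix w assume w: "w \<in> N - U"
        then have "{v, w} \<in> E" by (auto simp: N_def nbrs_def)
        moreover have "w \<in> insert v V - insert v U" using w NV vN by auto
        ultimately show "{v, w} \<in> ?C (insert v U)" by blast
      qed
    qed simp
    then have "card E \<le> 2 * card (?C (insert v U))" using E IH False by linarith
    moreover have "insert v U \<subseteq> insert v V" using U by auto
    ultimately show ?thesis by blast
  qed
qed

text \<open>Makes room for doubling: a graph on at most n/2 vertices still has at most n vertices
  afterwards.\<close>

lemma dense_small_subgraph:
  assumes G: "n_vertex_graph n G" and n: "n \<ge> 4"
  shows "\<exists>V\<subseteq>verts G. 2 * card V \<le> n \<and> card (edges G) \<le> 64 * card {e \<in> edges G. e \<subseteq> V}"
proof -
  have simple: "simple_graph G" and card_V: "card (verts G) = n" and finV: "finite (verts G)"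
    using G by (auto simp: n_vertex_graph_def simple_graph_def)
  obtain h where h: "bij_betw h (verts G) {0..<n}"
    using ex_bij_betw_finite_nat[OF finV] card_V by auto
  \<comment> \<open>Blocks of at most n div 4 vertices: eight of them cover everything since n < 8s,
    and any two together have at most n/2 vertices. Each edge lies in the union of two blocks, so
    one of the 64 pairs captures a 1/64 share of the edges.\<close>
  define s where "s = n div 4"
  have s: "s > 0" "4 * s \<le> n" "n < 8 * s" using n unfolding s_def by presburger+
  define blk where "blk i = {v \<in> verts G. h v div s = i}" for i
  have blk: "card (blk i) \<le> s" for i
  proof -
    have "h ` blk i \<subseteq> {i * s..<i * s + s}"
    proof (rule image_subsetI)
      fix v assume "v \<in> blk i"
      then have "i = h v div s" by (simp add: blk_def)
      then have "h v = i * s + h v mod s" by simp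
      moreover have "h v mod s < s" using s by simp
      ultimately show "h v \<in> {i * s..<i * s + s}" by (simp only: atLeastLessThan_iff) linarith
    qed
    moreover have "inj_on h (blk i)" using h by (auto simp: blk_def bij_betw_def intro: inj_on_subset)
    ultimately have "card (blk i) \<le> card {i * s..<i * s + s}" by (intro card_inj_on_le) auto
    then show ?thesis by simp
  qed
  define D where "D q = {e \<in> edges G. e \<subseteq> blk (fst q) \<union> blk (snd q)}" for q
  have "edges G \<subseteq> (\<Union>q\<in>{..<8} \<times> {..<8}. D q)"
  proof
    fix e assume e: "e \<in> edges G"
    then obtain a b where ab: "e = {a, b}" "a \<in> verts G" "b \<in> verts G" by (rule edgeE[OF simple])
    have "h v div s < 8" if "v \<in> verts G" for v
    proof -
      have "h v < n" using h that by (auto simp: bij_betw_def)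
      then show ?thesis using s by (simp add: less_mult_imp_div_less)
    qed
    then have "(h a div s, h b div s) \<in> {..<8} \<times> {..<8}" using ab by simp
    moreover have "e \<in> D (h a div s, h b div s)" using e ab by (simp add: D_def blk_def)
    ultimately show "e \<in> (\<Union>q\<in>{..<8} \<times> {..<8}. D q)" by blast
  qed
  moreover have "finite (\<Union>q\<in>{..<8} \<times> {..<8}. D q)"
    using finite_edges[OF simple] by (auto simp: D_def)
  ultimately have "card (edges G) \<le> card (\<Union>q\<in>{..<8} \<times> {..<8}. D q)" by (rule card_mono[rotated])
  also have "\<dots> \<le> (\<Sum>q\<in>{..<8::nat} \<times> {..<8::nat}. card (D q))" by (rule card_UN_le) simp
  finally have sum: "card (edges G) \<le> (\<Sum>q\<in>{..<8::nat} \<times> {..<8::nat}. card (D q))" .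
  have "\<exists>q. card (edges G) \<le> 64 * card (D q)"
  proof (rule ccontr)
    assume "\<not> ?thesis"
    then have "64 * card (D q) < card (edges G)" for q by (simp only: not_ex not_le)
    moreover have "{..<8::nat} \<noteq> {}" by (simp add: lessThan_empty_iff)
    ultimately have "(\<Sum>q\<in>{..<8::nat} \<times> {..<8::nat}. 64 * card (D q)) < (\<Sum>q\<in>{..<8::nat} \<times> {..<8::nat}. card (edges G))"
      by (intro sum_strict_mono) auto
    then show False using sum by (simp add: card_cartesian_product flip: sum_distrib_left)
  qed
  then obtain q where q: "card (edges G) \<le> 64 * card (D q)" by blast
  show ?thesis
  proof (intro exI[of _ "blk (fst q) \<union> blk (snd q)"] conjI)
    show "blk (fst q) \<union> blk (snd q) \<subseteq> verts G" by (auto simp: blk_def)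
    have "card (blk (fst q) \<union> blk (snd q)) \<le> s + s"
      using card_Un_le[of "blk (fst q)" "blk (snd q)"] blk[of "fst q"] blk[of "snd q"] by linarith
    then show "2 * card (blk (fst q) \<union> blk (snd q)) \<le> n" using s by linarith
    show "card (edges G) \<le> 64 * card {e \<in> edges G. e \<subseteq> blk (fst q) \<union> blk (snd q)}"
      using q by (simp add: D_def)
  qed
qed

text \<open>The constant is 64 for the restriction to half of the vertices times 2 for the
  cut.\<close>

lemma ex_family_le_ex_copies:
  assumes n: "n \<ge> 4" and m: "5 \<le> m" "m \<le> 2 * k + 1"
  shows "ex_family n {cycle_graph (2 * i) | i. 2 \<le> i \<and> i \<le> k} \<le> 128 * ex_copies n (cycle_graph 3) (cycle_graph m)"
proof -
  let ?F = "{cycle_graph (2 * i) | i. 2 \<le> i \<and> i \<le> k}"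
  have "edges F \<noteq> {}" if "F \<in> ?F" for F
  proof -
    from that obtain i where "F = cycle_graph (2 * i)" "2 \<le> i" by blast
    then show ?thesis using edges_cycle_graph_nonempty[of "2 * i"] by simp
  qed
  then obtain G where G: "n_vertex_graph n G" "\<forall>F\<in>?F. free_of F G" "card (edges G) = ex_family n ?F"
    by (rule ex_family_attained)
  have simple: "simple_graph G" using G(1) by (simp add: n_vertex_graph_def)
  have no_cycle: "\<not> cycle_in (edges G) (2 * j) f" if "2 \<le> j" "j \<le> k" for j f
  proof -
    have "cycle_graph (2 * j) \<in> ?F" using that by blast
    with G(2) have "free_of (cycle_graph (2 * j)) G" by (rule bspec)
    then show ?thesis using that free_of_cycle_iff[OF simple, of "2 * j"] by simp
  qed
  obtain V where V: "V \<subseteq> verts G" "2 * card V \<le> n" "card (edges G) \<le> 64 * card {e \<in> edges G. e \<subseteq> V}"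
    using dense_small_subgraph[OF G(1) n] by blast
  have finV: "finite V" using V(1) simple finite_subset by (auto simp: simple_graph_def)
  let ?E = "{e \<in> edges G. e \<subseteq> V}"
  have "\<exists>U\<subseteq>V. card ?E \<le> 2 * card {e \<in> ?E. \<exists>x\<in>U. \<exists>y\<in>V - U. e = {x, y}}"
    using finite_edges[OF simple] simple by (intro max_cut[OF finV]) (auto simp: simple_graph_def)
  then obtain U where U: "U \<subseteq> V" "card ?E \<le> 2 * card {e \<in> ?E. \<exists>x\<in>U. \<exists>y\<in>V - U. e = {x, y}}" by blast
  define H where "H = double_graph U (V - U) ?E"
  have disj: "U \<inter> (V - U) = {}" and fin: "finite U" "finite (V - U)"
    using U(1) finV finite_subset by auto
  have "card (triangles (edges H)) \<le> ex_copies n (cycle_graph 3) (cycle_graph m)"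
  proof (rule ex_copies_ge)
    show "simple_graph H" unfolding H_def by (rule simple_double_graph[OF disj fin])
    have "card (verts H) \<le> card (V \<times> (UNIV :: bool set))"
      unfolding H_def double_graph_def fst_conv using finV U(1) by (intro card_mono) auto
    also have "\<dots> \<le> n" using V(2) by (simp add: card_cartesian_product)
    finally show "card (verts H) \<le> n" .
    have "\<not> cycle_in ?E (2 * j) f" if "2 \<le> j" "j \<le> k" for j f
      using no_cycle[OF that, of f] by (auto simp: cycle_in_def)
    from no_cycle_in_double_graph[OF disj fin this m]
    show "\<nexists>f. cycle_in (edges H) m f" by (auto simp: H_def)
    show "m > 0" using m by simp
  qed
  moreover have "card {e \<in> ?E. \<exists>x\<in>U. \<exists>y\<in>V - U. e = {x, y}} \<le> card (triangles (edges H))"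
    unfolding H_def by (rule card_triangles_double_graph[OF disj fin])
  ultimately show ?thesis using V(3) U(2) G(3) by linarith
qed

section \<open>The polarity graph\<close>

definition dot :: "F2bar \<times> F2bar \<Rightarrow> F2bar \<times> F2bar \<Rightarrow> F2bar" where
  "dot u v = fst u * fst v + snd u * snd v"

text \<open>The affine part of the Erdos-Renyi polarity graph: pairs \<open>(a, b)\<close> stand for the
  projective points \<open>(a : b : 1)\<close>.\<close>

definition polarity_graph :: "nat \<Rightarrow> (F2bar \<times> F2bar) ugraph" where
  "polarity_graph m = (GF m \<times> GF m,
     {{u, v} | u v. u \<in> GF m \<times> GF m \<and> v \<in> GF m \<times> GF m \<and> u \<noteq> v \<and> dot u v = 1})"

lemma dot_commute: "dot u v = dot v u"
  by (simp add: dot_def mult.commute)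

lemma polarity_edge_iff:
  "{u, v} \<in> edges (polarity_graph m) \<longleftrightarrow>
    u \<in> GF m \<times> GF m \<and> v \<in> GF m \<times> GF m \<and> u \<noteq> v \<and> dot u v = 1"
proof
  assume "{u, v} \<in> edges (polarity_graph m)"
  then obtain u' v' where e: "{u, v} = {u', v'}" "u' \<in> GF m \<times> GF m" "v' \<in> GF m \<times> GF m" "u' \<noteq> v'" "dot u' v' = 1"
    unfolding polarity_graph_def snd_conv by (elim CollectE exE conjE)
  from e(1) consider "u = u'" "v = v'" | "u = v'" "v = u'" unfolding doubleton_eq_iff by argo
  then show "u \<in> GF m \<times> GF m \<and> v \<in> GF m \<times> GF m \<and> u \<noteq> v \<and> dot u v = 1"
  proof cases
    case 1
    show ?thesis unfolding 1 by (intro conjI e(2-5))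
  next
    case 2
    show ?thesis unfolding 2 by (intro conjI e(2,3) not_sym[OF e(4)] trans[OF dot_commute e(5)])
  qed
next
  assume "u \<in> GF m \<times> GF m \<and> v \<in> GF m \<times> GF m \<and> u \<noteq> v \<and> dot u v = 1"
  then show "{u, v} \<in> edges (polarity_graph m)"
    unfolding polarity_graph_def snd_conv by (intro CollectI exI[of _ u] exI[of _ v]) simp
qed

lemma simple_polarity_graph:
  assumes "m > 0"
  shows "simple_graph (polarity_graph m)"
  unfolding simple_graph_def
proof (intro conjI ballI)
  show "finite (verts (polarity_graph m))" using assms by (simp add: polarity_graph_def finite_GF)
  fix e assume "e \<in> edges (polarity_graph m)"
  then obtain u v where "e = {u, v}" "u \<in> GF m \<times> GF m" "v \<in> GF m \<times> GF m" "u \<noteq> v"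
    unfolding polarity_graph_def snd_conv by blast
  then show "e \<subseteq> verts (polarity_graph m)" "card e = 2" by (simp_all add: polarity_graph_def)
qed

text \<open>Cramer's rule if the determinant is nonzero. Otherwise the lines are parallel, and since
  both equations have right-hand side 1, a common point makes their coefficients equal.\<close>

lemma two_lines_meet_once:
  fixes a b c d x y x' y' :: "'a::field"
  assumes "a * x + b * y = 1" "c * x + d * y = 1" "a * x' + b * y' = 1" "c * x' + d * y' = 1"
  shows "(a = c \<and> b = d) \<or> (x = x' \<and> y = y')"
proof (cases "a * d - b * c = 0")
  case True
  then have ad: "a * d = b * c" by simp
  have "a = a * (c * x + d * y)" using assms(2) by simp
  also have "\<dots> = c * (a * x) + (a * d) * y" by (simp add: algebra_simps)
  also have "\<dots> = c * (a * x + b * y)" by (simp add: ad algebra_simps)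
  finally have a: "a = c" using assms(1) by simp
  have "b = b * (c * x + d * y)" using assms(2) by simp
  also have "\<dots> = (b * c) * x + d * (b * y)" by (simp add: algebra_simps)
  also have "\<dots> = d * (a * x + b * y)" by (simp add: ad[symmetric] algebra_simps)
  finally have "b = d" using assms(1) by simp
  with a show ?thesis by simp
next
  case False
  have x: "(a * d - b * c) * s = d - b" if "a * s + b * t = 1" "c * s + d * t = 1" for s t
  proof -
    have "(a * d - b * c) * s = d * (a * s + b * t) - b * (c * s + d * t)" by (simp add: algebra_simps)
    then show ?thesis using that by simp
  qed
  have y: "(a * d - b * c) * t = a - c" if "a * s + b * t = 1" "c * s + d * t = 1" for s t
  proof -
    have "(a * d - b * c) * t = a * (c * s + d * t) - c * (a * s + b * t)" by (simp add: algebra_simps)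
    then show ?thesis using that by simp
  qed
  have "(a * d - b * c) * x = (a * d - b * c) * x'" "(a * d - b * c) * y = (a * d - b * c) * y'"
    using x[OF assms(1,2)] x[OF assms(3,4)] y[OF assms(1,2)] y[OF assms(3,4)] by simp_all
  with False show ?thesis by simp
qed

text \<open>Two opposite vertices of a C_4 are the coefficients of two lines that both pass through
  the other two vertices.\<close>

lemma polarity_graph_C4_free: "\<not> cycle_in (edges (polarity_graph m)) 4 f"
proof
  assume f: "cycle_in (edges (polarity_graph m)) 4 f"
  have edge: "{f i, f (Suc i mod 4)} \<in> edges (polarity_graph m)" if "i < 4" for i
    using f that by (simp add: cycle_in_def)
  have dot: "dot (f i) (f (Suc i mod 4)) = 1" if "i < 4" for i
    using edge[OF that] unfolding polarity_edge_iff by blast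
  have mods: "Suc 0 mod 4 = 1" "Suc 1 mod 4 = 2" "Suc 2 mod 4 = 3" "Suc 3 mod 4 = 0" by simp_all
  have "dot (f 0) (f 1) = 1" by (rule dot[of 0, unfolded mods]) simp
  moreover have "dot (f 1) (f 2) = 1" by (rule dot[of 1, unfolded mods]) simp
  moreover have "dot (f 2) (f 3) = 1" by (rule dot[of 2, unfolded mods]) simp
  moreover have "dot (f 3) (f 0) = 1" by (rule dot[of 3, unfolded mods]) simp
  ultimately have "dot (f 0) (f 1) = 1" "dot (f 2) (f 1) = 1" "dot (f 0) (f 3) = 1" "dot (f 2) (f 3) = 1"
    using dot_commute[of "f 1" "f 2"] dot_commute[of "f 3" "f 0"] by (simp_all only:)
  from two_lines_meet_once[OF this[unfolded dot_def]] have "f 0 = f 2 \<or> f 1 = f 3"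
    by (simp only: prod_eq_iff)
  moreover have "inj_on f {..<4}" using f by (simp add: cycle_in_def)
  ultimately show False by (auto simp: inj_on_eq_iff)
qed

lemma F2bar_square_eq_1_iff: "(x::F2bar) * x = 1 \<longleftrightarrow> x = 1"
  by (simp add: square_eq_1_iff)

text \<open>Cramer's rule, with the signs lost in characteristic two, for the point w with
  \<open>dot u w = 1\<close> and \<open>dot v w = 1\<close>.\<close>

definition third_vertex :: "F2bar \<times> F2bar \<Rightarrow> F2bar \<times> F2bar \<Rightarrow> F2bar \<times> F2bar" where
  "third_vertex u v = ((snd u + snd v) / (fst u * snd v + snd u * fst v),
     (fst u + fst v) / (fst u * snd v + snd u * fst v))"

text \<open>For b \<noteq> 0 the neighbours of u = (a, b) are parametrised by their first coordinate
  c. As \<open>dot u u\<close> is the square of a + b, the second condition on a keeps u off its own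
  line, and the first condition on c does the same for v; this makes the three vertices distinct.
  The second condition on c makes the determinant in \<open>third_vertex\<close> nonzero, and a
  \<noteq> b permits the divisions.\<close>

lemma polarity_triangle:
  assumes F: "a \<in> GF m" "b \<in> GF m" "c \<in> GF m" and b: "b \<noteq> 0" and a: "a \<noteq> b" "a \<noteq> b + 1"
    and c: "c \<noteq> (b + 1) / (a + b)" "c \<noteq> a / ((a + b) * (a + b))"
  defines "u \<equiv> (a, b)" and "v \<equiv> (c, (1 + a * c) / b)"
  shows "{u, v, third_vertex u v} \<in> triangles (edges (polarity_graph m))"
proof -
  define d where "d = (1 + a * c) / b"
  define \<Delta> where "\<Delta> = a * d + b * c"
  define w where "w = third_vertex u v"
  have v: "v = (c, d)" by (simp add: v_def d_def)
  have w: "w = ((b + d) / \<Delta>, (a + c) / \<Delta>)"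
    by (simp add: w_def third_vertex_def u_def v \<Delta>_def)
  have bd: "b * d = 1 + a * c" using b by (simp add: d_def)
  have ab: "a + b \<noteq> 0" using a(1) by (simp add: F2bar_add_eq_0_iff)
  have "b * \<Delta> = a * (b * d) + b * b * c" by (simp add: \<Delta>_def algebra_simps)
  also have "\<dots> = a + c * ((a + b) * (a + b))"
    by (simp add: bd algebra_simps)
  also have "\<dots> \<noteq> 0"
  proof
    assume "a + c * ((a + b) * (a + b)) = 0"
    then have "a = c * ((a + b) * (a + b))" unfolding F2bar_add_eq_0_iff .
    then have "a / ((a + b) * (a + b)) = c * ((a + b) * (a + b)) / ((a + b) * (a + b))" by (rule arg_cong)
    also have "\<dots> = c" using ab by (intro nonzero_mult_div_cancel_right) simp
    finally show False using c(2) by blast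
  qed
  finally have \<Delta>: "\<Delta> \<noteq> 0" by (elim contrapos_nn) (simp only: mult_zero_right)
  have uv: "dot u v = 1" by (simp add: dot_def u_def v bd)
  have uw: "dot u w = 1"
  proof -
    have "dot u w = (a * (b + d) + b * (a + c)) / \<Delta>" by (simp add: dot_def u_def w flip: add_divide_distrib)
    also have "a * (b + d) + b * (a + c) = \<Delta>" by (simp add: \<Delta>_def algebra_simps)
    finally show ?thesis using \<Delta> by simp
  qed
  have vw: "dot v w = 1"
  proof -
    have "dot v w = (c * (b + d) + d * (a + c)) / \<Delta>" by (simp add: dot_def v w flip: add_divide_distrib)
    also have "c * (b + d) + d * (a + c) = \<Delta>" by (simp add: \<Delta>_def algebra_simps)
    finally show ?thesis using \<Delta> by simp
  qed
  have "a + b \<noteq> 1"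
  proof
    assume "a + b = 1"
    then have "b + (b + a) = b + 1" by (simp only: add.commute)
    with a(2) show False by simp
  qed
  moreover have "dot u u = (a + b) * (a + b)" by (simp add: dot_def u_def algebra_simps)
  ultimately have uu: "dot u u \<noteq> 1" by (simp add: F2bar_square_eq_1_iff)
  have "c + d \<noteq> 1"
  proof
    assume "c + d = 1"
    then have "b * (c + d) = b" by simp
    then have "c * (a + b) + 1 = b" using bd by (simp add: algebra_simps)
    then have "(c * (a + b) + 1) + 1 = b + 1" by (simp only:)
    then have "c * (a + b) = b + 1" by (simp only: add.assoc F2bar_add_self add_0_right)
    then have "c * (a + b) / (a + b) = (b + 1) / (a + b)" by (rule arg_cong)
    then show False using c(1) nonzero_mult_div_cancel_right[OF ab, of c] by simp
  qed
  moreover have "dot v v = (c + d) * (c + d)" by (simp add: dot_def v algebra_simps)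
  ultimately have vv: "dot v v \<noteq> 1" by (simp add: F2bar_square_eq_1_iff)
  have ne: "u \<noteq> v" "v \<noteq> w" "u \<noteq> w" using uv vw uw uu vv by auto
  have d: "d \<in> GF m" unfolding d_def using F by (intro GF_closed)
  then have "\<Delta> \<in> GF m" unfolding \<Delta>_def using F by (intro GF_closed)
  then have mem: "u \<in> GF m \<times> GF m" "v \<in> GF m \<times> GF m" "w \<in> GF m \<times> GF m"
    using F d by (simp_all add: u_def v w GF_closed(3,5))
  show ?thesis
    using ne mem uv uw vw unfolding w_def[symmetric]
    by (intro trianglesI) (simp_all add: polarity_edge_iff)
qed

lemma card_triangle: "T \<in> triangles E \<Longrightarrow> card T = 3 \<and> finite T"
  by (elim trianglesE) simp

text \<open>There are 2^m - 1 choices of b and at least 2^m - 2 each for a and c. A choice is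
  recovered from the ordered pair (u, v), and a triangle T has 9 pairs in T \<times> T.\<close>

lemma card_triangles_polarity_graph:
  assumes m: "m > 0"
  shows "(2 ^ m - 1) * (2 ^ m - 2) ^ 2 \<le> (9 :: nat) * card (triangles (edges (polarity_graph m)))"
proof -
  let ?Tri = "triangles (edges (polarity_graph m))"
  define A where "A b = GF m - {b, b + 1}" for b
  define C where "C b a = GF m - {(b + 1) / (a + b), a / ((a + b) * (a + b))}" for a b
  define P where "P = (SIGMA b:GF m - {0}. SIGMA a:A b. C b a)"
  have fin: "finite (GF m)" using m by (rule finite_GF)
  have finA: "finite (A b)" and finC: "finite (C b a)" for a b using fin by (auto simp: A_def C_def)
  have minus2: "2 ^ m - 2 \<le> card (GF m - {x, y})" for x y
  proof -
    have "card (GF m) - card {x, y} \<le> card (GF m - {x, y})" by (rule diff_card_le_card_Diff) simp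
    moreover have "card {x, y} \<le> 2" by (simp add: card_insert_if)
    ultimately show ?thesis using card_GF[OF m] by linarith
  qed
  have inner: "(2 ^ m - 2) ^ 2 \<le> card (SIGMA a:A b. C b a)" for b
  proof -
    have "(2 ^ m - 2) ^ 2 \<le> card (A b) * (2 ^ m - 2)"
      using minus2[of b "b + 1"] by (simp add: power2_eq_square A_def)
    also have "\<dots> = (\<Sum>a\<in>A b. 2 ^ m - 2)" by simp
    also have "\<dots> \<le> (\<Sum>a\<in>A b. card (C b a))"
      using minus2 by (intro sum_mono) (simp add: C_def)
    also have "\<dots> = card (SIGMA a:A b. C b a)" using finA finC by (simp add: card_SigmaI)
    finally show ?thesis .
  qed
  have "(2 ^ m - 1) * (2 ^ m - 2) ^ 2 = (\<Sum>b\<in>GF m - {0}. (2 ^ m - 2 :: nat) ^ 2)"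
    using card_GF[OF m] GF_closed(1)[of m] by simp
  also have "\<dots> \<le> (\<Sum>b\<in>GF m - {0}. card (SIGMA a:A b. C b a))"
    by (intro sum_mono inner)
  also have "\<dots> = card P"
    unfolding P_def using fin finA finC by (intro card_SigmaI[symmetric]) auto
  also have "\<dots> \<le> card (SIGMA T:?Tri. T \<times> T)"
  proof (rule card_inj_on_le)
    let ?v = "\<lambda>b a c. (c, (1 + a * c) / b)"
    let ?h = "\<lambda>(b, a, c). ({(a, b), ?v b a c, third_vertex (a, b) (?v b a c)}, ((a, b), ?v b a c))"
    show "inj_on ?h P" by (auto simp: inj_on_def)
    show "?h ` P \<subseteq> (SIGMA T:?Tri. T \<times> T)"
    proof (rule image_subsetI)
      fix p assume "p \<in> P"
      then obtain a b c where p: "p = (b, a, c)" "b \<in> GF m" "b \<noteq> 0" "a \<in> A b" "c \<in> C b a"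
        unfolding P_def by blast
      then have "{(a, b), ?v b a c, third_vertex (a, b) (?v b a c)} \<in> ?Tri"
        by (intro polarity_triangle) (simp_all add: A_def C_def)
      then show "?h p \<in> (SIGMA T:?Tri. T \<times> T)" unfolding p(1) by simp
    qed
    show "finite (SIGMA T:?Tri. T \<times> T)"
      using finite_triangles[OF simple_polarity_graph[OF m]] card_triangle by auto
  qed
  also have "\<dots> = (\<Sum>T\<in>?Tri. card (T \<times> T))"
    using finite_triangles[OF simple_polarity_graph[OF m]] card_triangle by (intro card_SigmaI) auto
  also have "\<dots> = (\<Sum>T\<in>?Tri. 9)"
    by (intro sum.cong) (simp_all add: card_cartesian_product card_triangle)
  finally show ?thesis by simp
qed

lemma ex_copies_C4_ge:
  assumes "m > 0" "2 ^ (2 * m) \<le> n"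
  shows "(2 ^ m - 1) * (2 ^ m - 2) ^ 2 \<le> (9 :: nat) * ex_copies n (cycle_graph 3) (cycle_graph 4)"
proof -
  have "card (triangles (edges (polarity_graph m))) \<le> ex_copies n (cycle_graph 3) (cycle_graph 4)"
  proof (rule ex_copies_ge)
    show "simple_graph (polarity_graph m)" using assms by (intro simple_polarity_graph)
    show "card (verts (polarity_graph m)) \<le> n"
      using assms by (simp add: polarity_graph_def card_cartesian_product card_GF power_mult power2_eq_square mult_2 power_add)
  qed (simp_all add: polarity_graph_C4_free)
  with card_triangles_polarity_graph[OF assms(1)] show ?thesis by linarith
qed

section \<open>The Kovari-Sos-Turan bound for C_4\<close>

text \<open>Two distinct vertices have at most one common neighbour, so the sum of d(d - 1) over all
  degrees d is at most n^2.\<close>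

lemma C4_free_edges_le:
  assumes G: "n_vertex_graph n G" and free: "\<And>f. \<not> cycle_in (edges G) 4 f"
  shows "real (card (edges G)) \<le> real n * sqrt (real n)"
proof (cases "n = 0")
  case True
  with G have "verts G = {}" by (auto simp: n_vertex_graph_def simple_graph_def)
  with G have "edges G = {}" by (auto simp: n_vertex_graph_def simple_graph_def)
  then show ?thesis by simp
next
  case False
  have simple: "simple_graph G" and card_V: "card (verts G) = n" and finV: "finite (verts G)"
    using G by (auto simp: n_vertex_graph_def simple_graph_def)
  let ?N = "nbrs (edges G)"
  let ?d = "\<lambda>v. card (?N v)"
  have finN: "finite (?N v)" for v by (rule finite_nbrs[OF simple])
  define Q where "Q v = {q \<in> ?N v \<times> ?N v. fst q \<noteq> snd q}" for v
  have finQ: "finite (Q v)" for v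
    by (rule finite_subset[of _ "?N v \<times> ?N v"]) (auto simp: Q_def finN)
  have cardQ: "card (Q v) + ?d v = ?d v * ?d v" for v
  proof -
    have "?N v \<times> ?N v = Q v \<union> (\<lambda>a. (a, a)) ` ?N v" by (auto simp: Q_def)
    then have "card (?N v \<times> ?N v) = card (Q v) + card ((\<lambda>a. (a, a)) ` ?N v)"
      using finQ finN by (simp only:) (rule card_Un_disjoint, auto simp: Q_def)
    then show ?thesis by (simp add: card_cartesian_product card_image inj_on_def)
  qed
  have "card (SIGMA v:verts G. Q v) \<le> card (verts G \<times> verts G)"
  proof (rule card_inj_on_le[of snd])
    show "inj_on snd (SIGMA v:verts G. Q v)"
    proof (rule inj_onI)
      fix p p' assume pp: "p \<in> (SIGMA v:verts G. Q v)" "p' \<in> (SIGMA v:verts G. Q v)" "snd p = snd p'"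
      obtain v a b where p: "p = (v, a, b)" by (cases p) auto
      obtain v' where p': "p' = (v', a, b)" using pp(3) by (cases p') (auto simp: p)
      have q: "(a, b) \<in> Q v" "(a, b) \<in> Q v'" using pp by (auto simp: p p')
      then have e: "{v, a} \<in> edges G" "{v, b} \<in> edges G" "{v', a} \<in> edges G" "{v', b} \<in> edges G" "a \<noteq> b"
        by (auto simp: Q_def nbrs_def)
      have "x \<noteq> y" if "{x, y} \<in> edges G" for x y
        using that singleton_notin_edges[OF simple] by auto
      then have ne: "v \<noteq> a" "v \<noteq> b" "v' \<noteq> a" "v' \<noteq> b" using e by auto
      show "p = p'"
      proof (rule ccontr)
        assume "p \<noteq> p'"
        then have "v \<noteq> v'" by (simp add: p p')
        then have dist: "distinct [v, a, v', b]" using ne e(5) by auto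
        have "cycle_in (edges G) 4 ((!) [v, a, v', b])"
          unfolding cycle_in_def
        proof (intro conjI allI impI)
          show "inj_on ((!) [v, a, v', b]) {..<4}" by (rule inj_on_nth[OF dist]) simp
          fix i :: nat assume "i < 4"
          then consider "i = 0" | "i = 1" | "i = 2" | "i = 3" by linarith
          then show "{[v, a, v', b] ! i, [v, a, v', b] ! (Suc i mod 4)} \<in> edges G"
          proof cases
            case 1 then show ?thesis using e(1) by simp
          next
            case 2 then show ?thesis using e(3) by (simp add: insert_commute[of a v'])
          next
            case 3 then show ?thesis using e(4) by simp
          next
            case 4 then show ?thesis using e(2) by (simp add: insert_commute[of b v])
          qed
        qed
        with free show False by blast
      qed
    qed
    show "snd ` (SIGMA v:verts G. Q v) \<subseteq> verts G \<times> verts G"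
      using nbrs_subset[OF simple] by (fastforce simp: Q_def)
  qed (use finV in simp)
  then have "(\<Sum>v\<in>verts G. card (Q v)) \<le> n * n"
    using finV finQ card_V by (simp add: card_SigmaI card_cartesian_product)
  moreover have "(\<Sum>v\<in>verts G. card (Q v)) + 2 * card (edges G) = (\<Sum>v\<in>verts G. ?d v * ?d v)"
    by (simp only: cardQ[symmetric] sum.distrib sum_card_nbrs[OF simple])
  ultimately have "(\<Sum>v\<in>verts G. ?d v * ?d v) \<le> n * n + 2 * card (edges G)" by simp
  then have squares: "(\<Sum>v\<in>verts G. real (?d v) * real (?d v)) \<le> real n * real n + 2 * real (card (edges G))"
    by (simp flip: of_nat_mult of_nat_add of_nat_sum)
  \<comment> \<open>The inequality 2td \<le> d^2 + t^2 turns the bound on squares of degrees into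
    one on their sum. With t^2 = n both terms on the right contribute about n^2.\<close>
  define t where "t = sqrt (real n)"
  have t: "t \<ge> 1" "t * t = real n" using False by (auto simp: t_def)
  have "2 * t * real (2 * card (edges G)) = (\<Sum>v\<in>verts G. 2 * t * real (?d v))"
    by (simp only: sum_card_nbrs[OF simple, symmetric] of_nat_sum sum_distrib_left)
  also have "\<dots> \<le> (\<Sum>v\<in>verts G. real (?d v) * real (?d v) + t * t)"
  proof (rule sum_mono)
    fix v
    have "0 \<le> (real (?d v) - t) * (real (?d v) - t)" by simp
    then show "2 * t * real (?d v) \<le> real (?d v) * real (?d v) + t * t" by (simp add: algebra_simps)
  qed
  also have "\<dots> \<le> 2 * (real n * real n) + 2 * real (card (edges G))"
    using squares by (simp add: sum.distrib card_V t(2))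
  finally have "(2 * t - 1) * real (card (edges G)) \<le> real n * real n" by (simp add: algebra_simps)
  moreover have "t * real (card (edges G)) \<le> (2 * t - 1) * real (card (edges G))"
    using t(1) by (intro mult_right_mono) auto
  moreover have "real n * real n = t * (real n * t)" using t(2) by (metis mult.assoc mult.commute)
  ultimately have "t * real (card (edges G)) \<le> t * (real n * t)" by linarith
  then show ?thesis using t(1) by (simp add: t_def)
qed

section \<open>Asymptotics\<close>

text \<open>The constructions exist only for sizes a c^m. The largest one that fits is within a
  factor c of n, which costs only a constant.\<close>

lemma power_scale:
  fixes a c n :: nat
  assumes "a > 0" "c \<ge> 2" "a * c ^ j \<le> n"
  obtains m where "m \<ge> j" "a * c ^ m \<le> n" "n < a * c ^ Suc m"
proof -
  have "n < 2 ^ n" by simp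
  also have "\<dots> \<le> c ^ n" using assms(2) by (intro power_mono) simp_all
  also have "\<dots> \<le> a * c ^ n" using assms(1) by simp
  finally have big: "n < a * c ^ n" .
  define l where "l = (LEAST l. n < a * c ^ l)"
  have l: "n < a * c ^ l" unfolding l_def using big by (rule LeastI)
  have "j < l"
  proof (rule ccontr)
    assume "\<not> j < l"
    then have "c ^ l \<le> c ^ j" using assms(2) by (intro power_increasing) simp_all
    then have "a * c ^ l \<le> a * c ^ j" by simp
    with l assms(3) show False by linarith
  qed
  then obtain m where m: "l = Suc m" "j \<le> m" by (cases l) simp_all
  have "\<not> n < a * c ^ m" using not_less_Least[of m "\<lambda>l. n < a * c ^ l"] m(1) by (simp add: l_def)
  then show ?thesis using that[of m] l m by simp
qed

lemma ex_copies_rainbow_lower_bound: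
  assumes k: "k \<ge> 2" and l: "odd k \<and> l = 2 * k \<or> even k \<and> l = 2 * k + 1"
  shows "(\<lambda>n. real (ex_copies_rainbow n (cycle_graph 3) (cycle_graph l))) \<in> \<Omega>(\<lambda>n. real n powr (1 + 1 / real k))"
proof (rule landau_omega.bigI)
  define c :: nat where "c = 2 ^ k"
  \<comment> \<open>From n < 3 c^(m+1) and c = 2^k, the power n^(1+1/k) is at most 9 c^(m+1)
    2^(m+1), where 9 bounds 3^(1+1/k). This is 36c times c^m 2^m / 2, a lower bound for the number
    of triangles.\<close>
  show "1 / (36 * real c) > 0" by (simp add: c_def)
  have c: "c \<ge> 2" using k one_le_power[of "2::nat" "k - 1"] by (cases k) (simp_all add: c_def)
  show "\<forall>\<^sub>F n in at_top. norm (real (ex_copies_rainbow n (cycle_graph 3) (cycle_graph l)))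
      \<ge> 1 / (36 * real c) * norm (real n powr (1 + 1 / real k))"
    using eventually_ge_at_top[of "3 * c ^ 1"]
  proof eventually_elim
    case (elim n)
    obtain m where m: "m \<ge> 1" "3 * c ^ m \<le> n" "n < 3 * c ^ Suc m"
      using power_scale[OF _ c elim] by auto
    have cm: "c ^ m = 2 ^ (m * k)" by (simp add: c_def mult.commute flip: power_mult)
    have "2 ^ (m * k) * (2 ^ m - 1) \<le> ex_copies_rainbow n (cycle_graph 3) (cycle_graph l)"
      using m k l by (intro ex_copies_rainbow_ge_bch) (simp_all add: cm)
    then have "real (c ^ m * (2 ^ m - 1)) \<le> real (ex_copies_rainbow n (cycle_graph 3) (cycle_graph l))"
      unfolding cm by (simp only: of_nat_le_iff)
    moreover have "real c ^ m * (2 ^ m / 2) \<le> real (c ^ m * (2 ^ m - 1))"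
    proof -
      have "(2::real) \<le> 2 ^ m" using m(1) power_increasing[of 1 m "2::real"] by simp
      then have "(2::real) ^ m / 2 \<le> 2 ^ m - 1" by simp
      then have "real c ^ m * (2 ^ m / 2) \<le> real c ^ m * (2 ^ m - 1)" by (rule mult_left_mono) simp
      then show ?thesis by (simp add: of_nat_diff)
    qed
    ultimately have low: "real c ^ m * (2 ^ m / 2) \<le> real (ex_copies_rainbow n (cycle_graph 3) (cycle_graph l))"
      by linarith
    have kr: "real k \<ge> 2" using k by simp
    have root: "(real c ^ Suc m) powr (1 / real k) = 2 ^ Suc m"
    proof -
      have "real c ^ Suc m = (2 ^ Suc m) ^ k" by (simp add: c_def mult.commute flip: power_mult)
      also have "\<dots> = (2 ^ Suc m) powr real k" by (simp add: powr_realpow)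
      finally have "(real c ^ Suc m) powr (1 / real k) = (2 ^ Suc m) powr (real k * (1 / real k))"
        by (simp only: powr_powr)
      also have "real k * (1 / real k) = 1" using kr by simp
      finally show ?thesis by simp
    qed
    have c0: "real c > 0" using c by simp
    have three: "(3::real) powr (1 + 1 / real k) \<le> 9"
    proof -
      have "(3::real) powr (1 + 1 / real k) \<le> 3 powr 2" using kr by (intro powr_mono) simp_all
      then show ?thesis by simp
    qed
    have "real n \<le> 3 * real c ^ Suc m" using m(3) by (metis less_imp_le of_nat_le_iff of_nat_mult of_nat_numeral of_nat_power)
    then have "real n powr (1 + 1 / real k) \<le> (3 * real c ^ Suc m) powr (1 + 1 / real k)"
      using kr by (intro powr_mono2) simp_all
    also have "\<dots> = 3 powr (1 + 1 / real k) * (real c ^ Suc m) powr (1 + 1 / real k)"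
      by (rule powr_mult)
    also have "(real c ^ Suc m) powr (1 + 1 / real k) = real c ^ Suc m * 2 ^ Suc m"
      unfolding powr_add root using c0 by simp
    also have "3 powr (1 + 1 / real k) * (real c ^ Suc m * 2 ^ Suc m) \<le> 9 * (real c ^ Suc m * 2 ^ Suc m)"
      using three c0 by (intro mult_right_mono) simp_all
    also have "\<dots> = 36 * real c * (real c ^ m * (2 ^ m / 2))" by simp
    also have "\<dots> \<le> 36 * real c * real (ex_copies_rainbow n (cycle_graph 3) (cycle_graph l))"
      using low c0 by (intro mult_left_mono) simp_all
    finally show ?case using c0 by (simp add: divide_simps mult.commute)
  qed
qed

lemma ex_family_C4_le: "real (ex_family n {cycle_graph 4}) \<le> real n * sqrt (real n)"
proof -
  have "\<And>F. F \<in> {cycle_graph 4} \<Longrightarrow> edges F \<noteq> {}" using edges_cycle_graph_nonempty[of 4] by simp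
  then obtain G where G: "n_vertex_graph n G" "\<forall>F\<in>{cycle_graph 4}. free_of F G"
      "card (edges G) = ex_family n {cycle_graph 4}"
    by (rule ex_family_attained)
  have "simple_graph G" using G(1) by (simp add: n_vertex_graph_def)
  then have "\<not> cycle_in (edges G) 4 f" for f using G(2) free_of_cycle_iff[of G 4] by simp
  from C4_free_edges_le[OF G(1) this] show ?thesis by (simp only: G(3))
qed

text \<open>With q = 2^m, the constant is 8 * 8 * 9: n < 4q^2 gives n^(3/2) \<le> 8q^3, for q \<ge>
  4 the product (q - 1)(q - 2)^2 is at least q^3 / 8, and 9 comes from counting triangles by
  pairs.\<close>

lemma ex_family_le_ex_copies_C4:
  assumes "n \<ge> 16"
  shows "real (ex_family n {cycle_graph 4}) \<le> 576 * real (ex_copies n (cycle_graph 3) (cycle_graph 4))"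
proof -
  have "1 * 4 ^ 2 \<le> n" using assms by simp
  then obtain m where m: "m \<ge> 2" "1 * 4 ^ m \<le> n" "n < 1 * 4 ^ Suc m"
    by (rule power_scale[rotated 2]) simp_all
  define q :: real where "q = 2 ^ m"
  have q: "q \<ge> 4" using m(1) power_increasing[of 2 m "2::real"] by (simp add: q_def)
  have four: "(4::real) ^ Suc m = (2 * q) * (2 * q)"
    by (simp add: q_def flip: power_mult_distrib)
  have n: "real n \<le> (2 * q) * (2 * q)"
    using m(3) unfolding four[symmetric] by (metis less_imp_le mult_1 of_nat_le_iff of_nat_numeral of_nat_power)
  then have "sqrt (real n) \<le> 2 * q" using q by (intro real_le_lsqrt) (simp_all add: power2_eq_square)
  then have "real n * sqrt (real n) \<le> (2 * q) * (2 * q) * (2 * q)"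
    using n q by (intro mult_mono) simp_all
  with ex_family_C4_le[of n] have up: "real (ex_family n {cycle_graph 4}) \<le> 8 * (q * q * q)" by simp
  have "(2::nat) \<le> 2 ^ m" using m(1) power_increasing[of 1 m "2::nat"] by simp
  then have "real ((2 ^ m - 1) * (2 ^ m - 2) ^ 2) = (q - 1) * (q - 2) ^ 2" by (simp add: q_def of_nat_diff)
  moreover have "(2 ^ m - 1) * (2 ^ m - 2) ^ 2 \<le> 9 * ex_copies n (cycle_graph 3) (cycle_graph 4)"
    using m by (intro ex_copies_C4_ge) (simp_all add: power_mult)
  ultimately have low: "(q - 1) * (q - 2) ^ 2 \<le> 9 * real (ex_copies n (cycle_graph 3) (cycle_graph 4))"
    by (metis of_nat_le_iff of_nat_mult of_nat_numeral)
  have "(q / 2) * (q / 2) ^ 2 \<le> (q - 1) * (q - 2) ^ 2"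
    using q by (intro mult_mono power_mono) simp_all
  then have "q * q * q \<le> 8 * ((q - 1) * (q - 2) ^ 2)" by (simp add: power2_eq_square)
  with up low show ?thesis by linarith
qed

text \<open>Only m = 4, that is C_2k for k = 2, needs the polarity graph; all other lengths are at
  least 5 and covered by doubling. The constant 576 serves both cases.\<close>

lemma ex_copies_bigomega_ex_family:
  assumes "k \<ge> 2" and m: "m = 2 * k \<or> m = 2 * k + 1"
  shows "(\<lambda>n. real (ex_copies n (cycle_graph 3) (cycle_graph m)))
    \<in> \<Omega>(\<lambda>n. real (ex_family n {cycle_graph (2 * i) | i. 2 \<le> i \<and> i \<le> k}))"
proof (rule landau_omega.bigI)
  show "1 / 576 > (0::real)" by simp
  show "\<forall>\<^sub>F n in at_top. norm (real (ex_copies n (cycle_graph 3) (cycle_graph m)))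
      \<ge> 1 / 576 * norm (real (ex_family n {cycle_graph (2 * i) | i. 2 \<le> i \<and> i \<le> k}))"
    using eventually_ge_at_top[of 16]
  proof eventually_elim
    case (elim n)
    have "real (ex_family n {cycle_graph (2 * i) | i. 2 \<le> i \<and> i \<le> k})
        \<le> 576 * real (ex_copies n (cycle_graph 3) (cycle_graph m))"
    proof (cases "m = 4")
      case True
      then have "k = 2" using assms by presburger
      then have "{cycle_graph (2 * i) | i. 2 \<le> i \<and> i \<le> k} = {cycle_graph 4}" by force
      then show ?thesis using ex_family_le_ex_copies_C4[OF elim] True by (simp only:)
    next
      case False
      then have "5 \<le> m" "m \<le> 2 * k + 1" using assms by presburger+
      from ex_family_le_ex_copies[OF _ this, of n] elim
      have "ex_family n {cycle_graph (2 * i) | i. 2 \<le> i \<and> i \<le> k}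
          \<le> 128 * ex_copies n (cycle_graph 3) (cycle_graph m)" by simp
      then show ?thesis by linarith
    qed
    then show ?case by simp
  qed
qed

theorem theorem1p6:
  fixes k :: nat
  assumes "k \<ge> 2"
  shows
    "(odd k \<longrightarrow>
       (\<lambda>n. real (ex_copies_rainbow n (cycle_graph 3) (cycle_graph (2 * k))))
         \<in> \<Omega>(\<lambda>n. real n powr (1 + 1 / real k))) \<and>
     (even k \<longrightarrow>
       (\<lambda>n. real (ex_copies_rainbow n (cycle_graph 3) (cycle_graph (2 * k + 1))))
         \<in> \<Omega>(\<lambda>n. real n powr (1 + 1 / real k))) \<and>
     (\<lambda>n. real (ex_copies_rainbow n (cycle_graph 3) (cycle_graph (2 * k))))
       \<in> O(\<lambda>n. real (ex_star n (cycle_graph (2 * k)))) \<and>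
     (\<forall>n. ex_copies_rainbow n (cycle_graph 3) (cycle_graph (2 * k))
            \<ge> ex_copies n (cycle_graph 3) (cycle_graph (2 * k))) \<and>
     (\<lambda>n. real (ex_copies n (cycle_graph 3) (cycle_graph (2 * k))))
       \<in> \<Omega>(\<lambda>n. real (ex_family n {cycle_graph (2 * i) | i. 2 \<le> i \<and> i \<le> k})) \<and>
     (\<forall>n. ex_copies_rainbow n (cycle_graph 3) (cycle_graph (2 * k + 1))
            \<ge> ex_copies n (cycle_graph 3) (cycle_graph (2 * k + 1))) \<and>
     (\<lambda>n. real (ex_copies n (cycle_graph 3) (cycle_graph (2 * k + 1))))
       \<in> \<Omega>(\<lambda>n. real (ex_family n {cycle_graph (2 * i) | i. 2 \<le> i \<and> i \<le> k}))"
proof (intro conjI impI allI)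
  show "(\<lambda>n. real (ex_copies_rainbow n (cycle_graph 3) (cycle_graph (2 * k))))
      \<in> \<Omega>(\<lambda>n. real n powr (1 + 1 / real k))" if "odd k"
    using that by (intro ex_copies_rainbow_lower_bound[OF assms]) simp
  show "(\<lambda>n. real (ex_copies_rainbow n (cycle_graph 3) (cycle_graph (2 * k + 1))))
      \<in> \<Omega>(\<lambda>n. real n powr (1 + 1 / real k))" if "even k"
    using that by (intro ex_copies_rainbow_lower_bound[OF assms]) simp
  show "(\<lambda>n. real (ex_copies_rainbow n (cycle_graph 3) (cycle_graph (2 * k))))
      \<in> O(\<lambda>n. real (ex_star n (cycle_graph (2 * k))))"
  proof (rule bigoI[where c = "real (6 * (2 * k))"], rule always_eventually, rule allI)
    fix n
    have "ex_copies_rainbow n (cycle_graph 3) (cycle_graph (2 * k)) \<le> 6 * (2 * k) * ex_star n (cycle_graph (2 * k))"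
      using assms by (intro ex_copies_rainbow_le_ex_star) simp
    then show "norm (real (ex_copies_rainbow n (cycle_graph 3) (cycle_graph (2 * k))))
        \<le> real (6 * (2 * k)) * norm (real (ex_star n (cycle_graph (2 * k))))"
      by (simp only: real_norm_def abs_of_nat of_nat_mult[symmetric] of_nat_le_iff)
  qed
  show "ex_copies n (cycle_graph 3) (cycle_graph (2 * k)) \<le> ex_copies_rainbow n (cycle_graph 3) (cycle_graph (2 * k))" for n
    using assms by (intro ex_copies_le_ex_copies_rainbow edges_cycle_graph_nonempty) simp
  show "ex_copies n (cycle_graph 3) (cycle_graph (2 * k + 1)) \<le> ex_copies_rainbow n (cycle_graph 3) (cycle_graph (2 * k + 1))" for n
    by (intro ex_copies_le_ex_copies_rainbow edges_cycle_graph_nonempty) simp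
  show "(\<lambda>n. real (ex_copies n (cycle_graph 3) (cycle_graph (2 * k))))
      \<in> \<Omega>(\<lambda>n. real (ex_family n {cycle_graph (2 * i) | i. 2 \<le> i \<and> i \<le> k}))"
    by (rule ex_copies_bigomega_ex_family[OF assms]) simp
  show "(\<lambda>n. real (ex_copies n (cycle_graph 3) (cycle_graph (2 * k + 1))))
      \<in> \<Omega>(\<lambda>n. real (ex_family n {cycle_graph (2 * i) | i. 2 \<le> i \<and> i \<le> k}))"
    by (rule ex_copies_bigomega_ex_family[OF assms]) simp
qed

end
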